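(* Let $G=(V,E)$ be a finite graph on $N$ vertices and order its eigenvalues in nondecreasing way: $0=\lambda_1<\lambda_2\le\dots\le\lambda_N$. Let $A_1,\dots,A_k$ be $k\geq 2$ disjoint nonempty subsets of $V$ and $\delta:=\min_{i\ne j}d(A_i,A_j)$. Then $$\lambda_k\le\frac{D_m}{\delta}\max_{i\ne j}\frac{\log\frac{2m(V)}{\sqrt{m(A_i)m(A_j)}}}{h\left(\frac2\delta\log\frac{2m(V)}{\sqrt{m(A_i)m(A_j)}}\right)},$$ where $h$ is the inverse function of $t\mapsto\zeta(t,1)$.
   Context: Graphs: $G=(V,E)$ is a connected graph with a symmetric weight $\mu_{\cdot\cdot}:V\times V\to[0,\infty)$, $\mu_{xy}>0$ iff $x\sim y$ (neighbors), $\deg(x):=\sum_{y}\mu_{xy}$. $m:V\to(0,\infty)$ is a measure on vertices, $m(B)=\sum_{x\in B}m(x)$, and $D_m:=\max_{x\in V}\deg(x)/m(x)$. $d$ is the combinatorial graph distance, $d(A,B)=\min_{a\in A,b\in B}d(a,b)$. The eigenvalues of $G$ are the eigenvalues (with multiplicity) of $-\Delta$, where $\Delta f(x)=\frac1{m(x)}\sum_{y}\mu_{xy}(f(y)-f(x))$. $\zeta(t,d)=d\,\mathrm{arcsinh}(d/t)-\sqrt{d^2+t^2}+t$ for $t>0$, $d\ge0$. The map $t\mapsto\zeta(t,1)$ is a strictly decreasing bijection of $(0,\infty)$ onto $(0,\infty)$; $h:(0,\infty)\to(0,\infty)$ denotes its inverse. *)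

theory Defs
  imports "HOL-Analysis.Analysis" "HOL-Library.Multiset"
begin

text \<open>
  A finite weighted graph has as its vertex set the finite type \<open>'v\<close>. Its edges are the pairs of
  positive weight. Loops are not excluded; they contribute to the degree but to neither the
  Laplacian nor the distance.
\<close>

definition neighbors :: "('v \<Rightarrow> 'v \<Rightarrow> real) \<Rightarrow> ('v \<times> 'v) set" where
  "neighbors \<mu> = {(x, y). \<mu> x y > 0}"

locale finite_weighted_graph =
  fixes \<mu> :: "'v::finite \<Rightarrow> 'v \<Rightarrow> real" and m :: "'v \<Rightarrow> real"
  assumes weight_nonneg: "\<mu> x y \<ge> 0"
    and weight_sym: "\<mu> x y = \<mu> y x"
    and measure_pos: "m x > 0"
    and connected: "(x, y) \<in> (neighbors \<mu>)\<^sup>*"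

definition weighted_degree :: "('v::finite \<Rightarrow> 'v \<Rightarrow> real) \<Rightarrow> 'v \<Rightarrow> real" where
  "weighted_degree \<mu> x = (\<Sum>y\<in>UNIV. \<mu> x y)"

definition max_degree :: "('v::finite \<Rightarrow> 'v \<Rightarrow> real) \<Rightarrow> ('v \<Rightarrow> real) \<Rightarrow> real" where
  "max_degree \<mu> m = Max (range (\<lambda>x. weighted_degree \<mu> x / m x))"

definition graph_dist :: "('v \<Rightarrow> 'v \<Rightarrow> real) \<Rightarrow> 'v \<Rightarrow> 'v \<Rightarrow> nat" where
  "graph_dist \<mu> x y = (LEAST n. (x, y) \<in> neighbors \<mu> ^^ n)"

definition set_graph_dist :: "('v \<Rightarrow> 'v \<Rightarrow> real) \<Rightarrow> 'v set \<Rightarrow> 'v set \<Rightarrow> nat" where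
  "set_graph_dist \<mu> A B = Min {graph_dist \<mu> a b | a b. a \<in> A \<and> b \<in> B}"

definition laplacian ::
    "('v::finite \<Rightarrow> 'v \<Rightarrow> real) \<Rightarrow> ('v \<Rightarrow> real) \<Rightarrow> real ^ 'v \<Rightarrow> real ^ 'v" where
  "laplacian \<mu> m f = (\<chi> x. 1 / m x * (\<Sum>y\<in>UNIV. \<mu> x y * (f $ y - f $ x)))"

definition eigenspace ::
    "('v::finite \<Rightarrow> 'v \<Rightarrow> real) \<Rightarrow> ('v \<Rightarrow> real) \<Rightarrow> real \<Rightarrow> (real ^ 'v) set" where
  "eigenspace \<mu> m c = {f. - laplacian \<mu> m f = c *\<^sub>R f}"

definition spectrum ::
    "('v::finite \<Rightarrow> 'v \<Rightarrow> real) \<Rightarrow> ('v \<Rightarrow> real) \<Rightarrow> real set" where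
  "spectrum \<mu> m = {c. \<exists>f. f \<noteq> 0 \<and> f \<in> eigenspace \<mu> m c}"

definition eigenvalues ::
    "('v::finite \<Rightarrow> 'v \<Rightarrow> real) \<Rightarrow> ('v \<Rightarrow> real) \<Rightarrow> real list" where
  "eigenvalues \<mu> m = sorted_list_of_multiset
     (\<Sum>c\<in>spectrum \<mu> m. replicate_mset (dim (eigenspace \<mu> m c)) c)"

text \<open>Eigenvalues are counted from 1, whereas list positions are counted from 0.\<close>

definition eigval ::
    "('v::finite \<Rightarrow> 'v \<Rightarrow> real) \<Rightarrow> ('v \<Rightarrow> real) \<Rightarrow> nat \<Rightarrow> real" where
  "eigval \<mu> m k = eigenvalues \<mu> m ! (k - 1)"

definition zeta :: "real \<Rightarrow> real \<Rightarrow> real" where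
  "zeta t d = d * arsinh (d / t) - sqrt (d\<^sup>2 + t\<^sup>2) + t"

text \<open>
  The map \<open>t \<mapsto> zeta t 1\<close> is a bijection of the positive half-line onto itself, so
  \<open>h s\<close> is only meaningful for \<open>s > 0\<close>.
\<close>

definition h :: "real \<Rightarrow> real" where
  "h = the_inv_into {0<..} (\<lambda>t. zeta t 1)"

end

theory Submission
  imports Defs "HOL-Real_Asymp.Real_Asymp"
begin

text \<open>
  Conjugating \<open>-\<Delta>\<close> by \<open>\<surd>m\<close> gives a symmetric operator \<open>S\<close> with the same eigenvalues, hence an orthonormal
  eigenbasis. Davies' method bounds the heat kernel between two sets at distance \<open>d\<close>: for \<open>\<psi>\<close> varying by
  at most \<open>s\<close> along edges, \<open>\<parallel>e\<^sup>\<psi> exp(-t S) f\<parallel>\<close> grows at rate at most \<open>D\<^sub>m (cosh s - 1)\<close>; taking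
  \<open>\<psi> = -s d(\<cdot>, B)\<close> and optimizing over \<open>s\<close> yields the factor \<open>exp (- \<zeta>(D\<^sub>m t, d))\<close>. Expanding the
  same heat kernel in the eigenbasis, for a suitable pair \<open>A\<^sub>i, A\<^sub>j\<close> the constant mode must be compensated
  by the modes from \<open>k\<close> on. At the time \<open>t\<close> with \<open>\<zeta>(D\<^sub>m t, \<delta>) = 2 L\<close>, where \<open>L\<close> is the largest
  logarithm, the Davies bound is too small to do so unless \<open>exp (-t \<lambda>\<^sub>k) \<ge> exp (-L)\<close>. Already
  \<open>\<zeta>(D\<^sub>m t, \<delta>) = L\<close> would suffice.
\<close>

subsection \<open>Spectral theorem for selfadjoint operators\<close>

text \<open>First variation: the residual \<open>w = f v - \<rho> v\<close> is orthogonal to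
  \<open>v\<close>. Moving to \<open>v + e w\<close> changes the form at first order by
  \<open>2 e (w \<bullet> w)\<close>, while maximality leaves room only for order
  \<open>e\<^sup>2\<close>; hence \<open>w = 0\<close>.\<close>

lemma rayleigh_maximizer_eigenvector:
  fixes f :: "'a::euclidean_space \<Rightarrow> 'a"
  assumes lin: "linear f" and sa: "\<And>x y. f x \<bullet> y = x \<bullet> f y"
    and S: "subspace S" "f ` S \<subseteq> S" and v: "v \<in> S" "norm v = 1"
    and max: "\<And>x. x \<in> S \<Longrightarrow> norm x = 1 \<Longrightarrow> x \<bullet> f x \<le> v \<bullet> f v"
  shows "f v = (v \<bullet> f v) *\<^sub>R v"
proof -
  define \<rho> where "\<rho> = v \<bullet> f v"
  define w where "w = f v - \<rho> *\<^sub>R v"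
  have vv: "v \<bullet> v = 1" using v by (simp add: norm_eq_1)
  have wS: "w \<in> S" unfolding w_def using S v by (auto intro!: subspace_diff subspace_scale)
  have wv: "w \<bullet> v = 0" by (simp add: w_def inner_diff vv \<rho>_def inner_commute)
  have wfv: "w \<bullet> f v = w \<bullet> w"
    by (metis (no_types, lifting) add.right_neutral diff_add_cancel inner_add_right inner_scaleR_right mult_zero_right w_def wv)
  have hom: "x \<bullet> f x \<le> \<rho> * (x \<bullet> x)" if "x \<in> S" for x
  proof (cases "x = 0")
    case True
    then show ?thesis by simp
  next
    case False
    let ?y = "(1 / norm x) *\<^sub>R x"
    have "?y \<bullet> f ?y \<le> \<rho>"
      unfolding \<rho>_def using that False S by (intro max) (auto intro: subspace_scale)
    then have "(x \<bullet> f x) / (norm x)\<^sup>2 \<le> \<rho>"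
      by (simp add: linear_scale[OF lin] power2_eq_square)
    then show ?thesis using False by (simp add: divide_le_eq power2_norm_eq_inner)
  qed
  have ineq: "2 * e * (w \<bullet> w) \<le> e\<^sup>2 * (\<rho> * (w \<bullet> w) - w \<bullet> f w)" for e
  proof -
    have "(v + e *\<^sub>R w) \<bullet> f (v + e *\<^sub>R w) \<le> \<rho> * ((v + e *\<^sub>R w) \<bullet> (v + e *\<^sub>R w))"
      by (intro hom subspace_add subspace_scale S v wS)
    moreover have "v \<bullet> f w = w \<bullet> w" using sa[of v w] wfv by (simp add: inner_commute)
    ultimately show ?thesis
      using wv wfv vv by (simp add: linear_add[OF lin] linear_scale[OF lin] inner_add inner_commute
          algebra_simps power2_eq_square flip: \<rho>_def)
  qed
  have "w \<bullet> w = 0"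
  proof (rule ccontr)
    assume "w \<bullet> w \<noteq> 0"
    then have a: "w \<bullet> w > 0" by simp
    define c where "c = \<rho> * (w \<bullet> w) - w \<bullet> f w"
    \<comment> \<open>This makes \<open>e * c\<close> at most \<open>w \<bullet> w\<close>, against
      \<open>2 * (w \<bullet> w) \<le> e * c\<close>; the \<open>+ 1\<close> covers
      \<open>c = 0\<close>.\<close>
    define e where "e = (w \<bullet> w) / (\<bar>c\<bar> + 1)"
    have e: "e > 0" using a by (simp add: e_def)
    have "2 * e * (w \<bullet> w) \<le> e * (e * c)" using ineq[of e] by (simp add: c_def power2_eq_square)
    then have "2 * (w \<bullet> w) \<le> e * c" using e by (simp add: mult.assoc)
    also have "\<dots> \<le> e * (\<bar>c\<bar> + 1)" using e by simp
    also have "\<dots> = w \<bullet> w" by (simp add: e_def)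
    finally show False using a by simp
  qed
  then show ?thesis by (simp add: w_def \<rho>_def)
qed

text \<open>Split off a maximizer of the Rayleigh quotient, which exists by compactness of the unit
  sphere. Selfadjointness makes its orthogonal complement in \<open>S\<close> invariant, and the
  induction continues there; this is why all invariant subspaces are treated at once.\<close>

lemma selfadjoint_eigenbasis_subspace:
  fixes f :: "'a::euclidean_space \<Rightarrow> 'a"
  assumes lin: "linear f" and sa: "\<And>x y. f x \<bullet> y = x \<bullet> f y"
  shows "subspace S \<Longrightarrow> f ` S \<subseteq> S \<Longrightarrow>
    \<exists>B. pairwise orthogonal B \<and> (\<forall>b\<in>B. norm b = 1 \<and> f b = (b \<bullet> f b) *\<^sub>R b) \<and> span B = S"
proof (induction "dim S" arbitrary: S rule: less_induct)
  case less
  show ?case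
  proof (cases "S = {0}")
    case True
    then show ?thesis by (intro exI[of _ "{}"]) auto
  next
    case False
    then obtain x where x: "x \<in> S" "x \<noteq> 0" using subspace_0[OF less.prems(1)] by blast
    let ?K = "S \<inter> sphere 0 1"
    have "(1 / norm x) *\<^sub>R x \<in> ?K" using x less.prems by (auto intro: subspace_scale)
    then have ne: "?K \<noteq> {}" by blast
    have "compact ?K" using closed_subspace[OF less.prems(1)] by (simp add: closed_Int_compact)
    moreover have "continuous_on ?K (\<lambda>x. x \<bullet> f x)"
      by (intro continuous_intros linear_continuous_on linear_conv_bounded_linear[THEN iffD1] lin)
    ultimately obtain v where v: "v \<in> ?K" "\<forall>y\<in>?K. y \<bullet> f y \<le> v \<bullet> f v"
      using continuous_attains_sup[OF _ ne] by blast
    then have vS: "v \<in> S" and nv: "norm v = 1" by auto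
    have fv: "f v = (v \<bullet> f v) *\<^sub>R v"
      using v by (intro rayleigh_maximizer_eigenvector[OF lin sa less.prems]) auto
    have vv: "v \<bullet> v = 1" using nv by (simp add: norm_eq_1)
    define S' where "S' = S \<inter> {x. v \<bullet> x = 0}"
    have S': "subspace S'" unfolding S'_def
      by (intro subspace_inter less.prems subspace_hyperplane)
    have "f ` S' \<subseteq> S'"
    proof
      fix y assume "y \<in> f ` S'"
      then obtain z where z: "y = f z" "z \<in> S" "v \<bullet> z = 0" by (auto simp: S'_def)
      have "v \<bullet> f z = f v \<bullet> z" by (simp add: sa)
      also have "\<dots> = 0" by (subst fv) (simp add: z)
      finally show "y \<in> S'" using z less.prems by (auto simp: S'_def)
    qed
    moreover have "v \<notin> S'" using vv by (simp add: S'_def)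
    then have "S' \<subset> S" using vS unfolding S'_def by blast
    then have "dim S' < dim S"
      by (intro dim_psubset) (metis S' less.prems(1) span_eq_iff)
    ultimately obtain B where B: "pairwise orthogonal B"
        "\<forall>b\<in>B. norm b = 1 \<and> f b = (b \<bullet> f b) *\<^sub>R b" "span B = S'"
      using less.hyps[of S'] S' by blast
    have BS: "b \<in> S'" if "b \<in> B" for b using B(3) that span_base by blast
    have "span (insert v B) = S"
    proof
      show "span (insert v B) \<subseteq> S"
        using BS vS less.prems(1) by (intro span_minimal) (auto simp: S'_def)
      show "S \<subseteq> span (insert v B)"
      proof
        fix y assume "y \<in> S"
        then have "y - (v \<bullet> y) *\<^sub>R v \<in> S'"
          using vS vv less.prems(1) by (auto simp: S'_def inner_diff intro!: subspace_diff subspace_scale)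
        then show "y \<in> span (insert v B)" using B(3) span_breakdown_eq by blast
      qed
    qed
    moreover have "pairwise orthogonal (insert v B)"
      using B(1) BS by (auto simp: pairwise_insert orthogonal_def S'_def inner_commute)
    ultimately show ?thesis using B(2) fv nv by (intro exI[of _ "insert v B"]) auto
  qed
qed

text \<open>Expanding \<open>f x = c x\<close> in \<open>B\<close>, independence kills every
  coefficient with \<open>lam b \<noteq> c\<close>.\<close>

lemma dim_eigenspace_orthonormal_basis:
  fixes f :: "'a::euclidean_space \<Rightarrow> 'a"
  assumes lin: "linear f" and B: "pairwise orthogonal B" "\<And>b. b \<in> B \<Longrightarrow> norm b = 1" "span B = UNIV"
    and eig: "\<And>b. b \<in> B \<Longrightarrow> f b = lam b *\<^sub>R b"
  shows "dim {x. f x = c *\<^sub>R x} = card {b\<in>B. lam b = c}"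
proof -
  have ind: "independent B" using B by (intro pairwise_orthogonal_independent) force+
  then have fin: "finite B" by (simp add: independent_imp_finite)
  let ?C = "{b\<in>B. lam b = c}"
  have "{x. f x = c *\<^sub>R x} = span ?C"
  proof
    show "span ?C \<subseteq> {x. f x = c *\<^sub>R x}"
      by (intro span_minimal subspaceI)
        (auto simp: eig linear_add[OF lin] linear_scale[OF lin] linear_0[OF lin] algebra_simps)
    show "{x. f x = c *\<^sub>R x} \<subseteq> span ?C"
    proof
      fix x assume "x \<in> {x. f x = c *\<^sub>R x}"
      then have fx: "f x = c *\<^sub>R x" by simp
      have x: "(\<Sum>b\<in>B. (x \<bullet> b) *\<^sub>R b) = x"
        by (rule orthonormal_basis_expand) (use B fin in auto)
      have "(\<Sum>b\<in>B. ((lam b - c) * (x \<bullet> b)) *\<^sub>R b) = f (\<Sum>b\<in>B. (x \<bullet> b) *\<^sub>R b) - c *\<^sub>R (\<Sum>b\<in>B. (x \<bullet> b) *\<^sub>R b)"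
        by (simp add: linear_sum[OF lin] linear_scale[OF lin] eig scaleR_right.sum
            sum_subtractf[symmetric] algebra_simps)
      also have "\<dots> = 0" unfolding x by (simp add: fx)
      finally have "(lam b - c) * (x \<bullet> b) = 0" if "b \<in> B" for b
        using independentD[OF ind fin subset_refl _ that] by metis
      then have "(\<Sum>b\<in>B. (x \<bullet> b) *\<^sub>R b) = (\<Sum>b\<in>?C. (x \<bullet> b) *\<^sub>R b)"
        by (intro sum.mono_neutral_right fin) auto
      also have "\<dots> \<in> span ?C" by (intro span_sum span_scale span_base)
      finally show "x \<in> span ?C" using x by simp
    qed
  qed
  moreover have "independent ?C" using ind by (rule independent_mono) auto
  ultimately show ?thesis by (simp add: dim_eq_card_independent)
qed

text \<open>Bridges two ways of counting: \<open>eigenvalues\<close> sums multiplicities over the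
  spectrum, an eigenbasis lists one value per vector.\<close>

lemma image_mset_mset_set_fibres:
  assumes "finite B"
  shows "(\<Sum>c\<in>f ` B. replicate_mset (card {b\<in>B. f b = c}) c) = image_mset f (mset_set B)"
proof (rule multiset_eqI)
  fix d
  have "count (\<Sum>c\<in>f ` B. replicate_mset (card {b\<in>B. f b = c}) c) d
      = (\<Sum>c\<in>f ` B. if d = c then card {b\<in>B. f b = c} else 0)"
    by (auto simp: count_sum intro!: sum.cong)
  also have "\<dots> = card {b\<in>B. f b = d}"
    using assms by (auto simp: sum.delta' intro!: card_eq_0_iff[THEN iffD2])
  also have "\<dots> = count (image_mset f (mset_set B)) d"
    using assms by (simp add: count_image_mset Int_def vimage_def conj_commute)
  finally show "count (\<Sum>c\<in>f ` B. replicate_mset (card {b\<in>B. f b = c}) c) d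
      = count (image_mset f (mset_set B)) d" .
qed

text \<open>The last conclusion copies the shape of \<open>eigenvalues\<close>, so that position
  \<open>i\<close> of that list is the eigenvalue of \<open>\<phi> i\<close>.\<close>

lemma selfadjoint_sorted_eigenbasis:
  fixes f :: "'a::euclidean_space \<Rightarrow> 'a"
  assumes lin: "linear f" and sa: "\<And>x y. f x \<bullet> y = x \<bullet> f y"
  obtains \<phi> :: "nat \<Rightarrow> 'a" and lam :: "nat \<Rightarrow> real"
    where "\<And>i j. i < DIM('a) \<Longrightarrow> j < DIM('a) \<Longrightarrow> \<phi> i \<bullet> \<phi> j = (if i = j then 1 else 0)"
      and "\<And>i. i < DIM('a) \<Longrightarrow> f (\<phi> i) = lam i *\<^sub>R \<phi> i"
      and "\<And>x. (\<Sum>i<DIM('a). (x \<bullet> \<phi> i) *\<^sub>R \<phi> i) = x"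
      and "\<And>i j. i \<le> j \<Longrightarrow> j < DIM('a) \<Longrightarrow> lam i \<le> lam j"
      and "sorted_list_of_multiset
        (\<Sum>c | \<exists>x. x \<noteq> 0 \<and> f x = c *\<^sub>R x. replicate_mset (dim {x. f x = c *\<^sub>R x}) c)
        = map lam [0..<DIM('a)]"
proof -
  obtain B where B: "pairwise orthogonal B" "\<And>b. b \<in> B \<Longrightarrow> norm b = 1" "span B = UNIV"
      and eig: "\<And>b. b \<in> B \<Longrightarrow> f b = (b \<bullet> f b) *\<^sub>R b"
    using selfadjoint_eigenbasis_subspace[OF lin sa subspace_UNIV] by blast
  have ind: "independent B" using B by (intro pairwise_orthogonal_independent) force+
  then have fin: "finite B" by (simp add: independent_imp_finite)
  have card: "card B = DIM('a)" by (metis B(3) dim_UNIV dim_eq_card_independent dim_span ind)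
  define q where "q b = b \<bullet> f b" for b
  obtain bs0 where bs0: "set bs0 = B" "distinct bs0" using finite_distinct_list[OF fin] by blast
  \<comment> \<open>On \<open>B\<close> the Rayleigh quotient \<open>q\<close> is the eigenvalue;
    sorting the vectors rather than the values keeps the two aligned.\<close>
  define bs where "bs = sort_key q bs0"
  have bs: "set bs = B" "distinct bs" "sorted (map q bs)" using bs0 by (auto simp: bs_def)
  have len: "length bs = DIM('a)" using bs card distinct_card by fastforce
  have inB: "bs ! i \<in> B" if "i < DIM('a)" for i using that bs(1) len nth_mem by metis
  have dimc: "dim {x. f x = c *\<^sub>R x} = card {b\<in>B. q b = c}" for c
    by (rule dim_eigenspace_orthonormal_basis[OF lin B]) (use eig in \<open>auto simp: q_def\<close>)
  have spec: "{c. \<exists>x. x \<noteq> 0 \<and> f x = c *\<^sub>R x} = q ` B"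
  proof
    show "q ` B \<subseteq> {c. \<exists>x. x \<noteq> 0 \<and> f x = c *\<^sub>R x}"
    proof
      fix c assume "c \<in> q ` B"
      then obtain b where b: "b \<in> B" "c = q b" by blast
      then have "b \<noteq> 0" using B(2) by force
      then show "c \<in> {c. \<exists>x. x \<noteq> 0 \<and> f x = c *\<^sub>R x}"
        using eig[OF b(1)] b(2) by (auto simp: q_def)
    qed
    show "{c. \<exists>x. x \<noteq> 0 \<and> f x = c *\<^sub>R x} \<subseteq> q ` B"
    proof
      fix c assume "c \<in> {c. \<exists>x. x \<noteq> 0 \<and> f x = c *\<^sub>R x}"
      then obtain x where "x \<noteq> 0" "f x = c *\<^sub>R x" by blast
      then have "dim {x. f x = c *\<^sub>R x} \<noteq> 0" by auto
      then have "{b\<in>B. q b = c} \<noteq> {}" unfolding dimc by (metis card.empty)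
      then show "c \<in> q ` B" by auto
    qed
  qed
  have bij: "bij_betw ((!) bs) {..<DIM('a)} B"
    using bs len by (metis bij_betw_nth)
  show thesis
  proof (rule that[of "(!) bs" "\<lambda>i. q (bs ! i)"])
    fix i j assume ij: "i < DIM('a)" "j < DIM('a)"
    have "orthogonal (bs ! i) (bs ! j)" if "i \<noteq> j"
      using B(1) inB ij that bs(2) len by (auto simp: pairwise_def nth_eq_iff_index_eq)
    then show "bs ! i \<bullet> bs ! j = (if i = j then 1 else 0)"
      using B(2)[OF inB[OF ij(1)]] by (auto simp: orthogonal_def norm_eq_1)
  next
    fix i assume "i < DIM('a)"
    then show "f (bs ! i) = q (bs ! i) *\<^sub>R bs ! i" unfolding q_def by (intro eig inB)
  next
    fix x
    have "(\<Sum>i<DIM('a). (x \<bullet> bs ! i) *\<^sub>R bs ! i) = (\<Sum>b\<in>B. (x \<bullet> b) *\<^sub>R b)"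
      by (rule sum.reindex_bij_betw[OF bij])
    also have "\<dots> = x" by (rule orthonormal_basis_expand) (use B fin in auto)
    finally show "(\<Sum>i<DIM('a). (x \<bullet> bs ! i) *\<^sub>R bs ! i) = x" .
  next
    fix i j assume "i \<le> j" "j < DIM('a)"
    then show "q (bs ! i) \<le> q (bs ! j)" using bs(3) len by (auto simp: sorted_iff_nth_mono)
  next
    have "(\<Sum>c\<in>q ` B. replicate_mset (card {b\<in>B. q b = c}) c) = mset (map q bs)"
      using bs fin by (simp add: image_mset_mset_set_fibres flip: mset_set_set)
    moreover have "sorted_list_of_multiset (mset (map q bs)) = map q bs"
      using bs(3) by (simp only: sorted_list_of_multiset_mset sorted_sort_id)
    moreover have "map q bs = map (\<lambda>i. q (bs ! i)) [0..<DIM('a)]"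
      by (rule nth_equalityI) (simp_all add: len)
    ultimately show "sorted_list_of_multiset
        (\<Sum>c | \<exists>x. x \<noteq> 0 \<and> f x = c *\<^sub>R x. replicate_mset (dim {x. f x = c *\<^sub>R x}) c)
        = map (\<lambda>i. q (bs ! i)) [0..<DIM('a)]"
      unfolding spec dimc by (simp only:)
  qed
qed

subsection \<open>Pairwise obtuse vectors\<close>

text \<open>Splitting a vanishing combination \<open>\<Sum>c\<^sub>w w\<close> by the signs of the coefficients gives two equal
  vectors whose inner product is nonpositive, so both vanish; pairing with \<open>z\<close> kills every coefficient.\<close>

lemma independent_if_pairwise_obtuse:
  fixes W :: "'a::real_inner set"
  assumes fin: "finite W" and neg: "pairwise (\<lambda>x y. x \<bullet> y < 0) W"
    and z: "\<And>w. w \<in> W \<Longrightarrow> w \<bullet> z < 0"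
  shows "independent W"
proof
  assume "dependent W"
  then obtain c where c: "(\<Sum>w\<in>W. c w *\<^sub>R w) = 0" "\<exists>w\<in>W. c w \<noteq> 0"
    using fin by (auto simp: dependent_finite)
  define P N where "P = {w\<in>W. c w > 0}" and "N = {w\<in>W. c w < 0}"
  define p where "p = (\<Sum>w\<in>P. c w *\<^sub>R w)"
  have finPN: "finite P" "finite N" using fin by (auto simp: P_def N_def)
  have "(\<Sum>w\<in>P \<union> N. c w *\<^sub>R w) = (\<Sum>w\<in>W. c w *\<^sub>R w)"
    by (intro sum.mono_neutral_left fin) (auto simp: P_def N_def)
  moreover have "(\<Sum>w\<in>P \<union> N. c w *\<^sub>R w) = p + (\<Sum>w\<in>N. c w *\<^sub>R w)"
    unfolding p_def by (intro sum.union_disjoint finPN) (auto simp: P_def N_def)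
  ultimately have pN: "p = (\<Sum>w\<in>N. (- c w) *\<^sub>R w)"
    using c(1) by (simp add: sum_negf eq_neg_iff_add_eq_0)
  have "p \<bullet> p = (\<Sum>w\<in>P. c w * (w \<bullet> p))"
    unfolding p_def inner_sum_left inner_scaleR_left ..
  also have "\<dots> = (\<Sum>w\<in>P. \<Sum>w'\<in>N. (c w * (- c w')) * (w \<bullet> w'))"
    unfolding pN inner_sum_right inner_scaleR_right sum_distrib_left by (simp only: mult.assoc)
  also have "\<dots> \<le> 0"
  proof (intro sum_nonpos)
    fix w w' assume w: "w \<in> P" "w' \<in> N"
    then have "w \<bullet> w' < 0" using neg by (auto simp: P_def N_def dest: pairwiseD[of _ W w w'])
    moreover have "c w * (- c w') > 0" using w by (auto simp: P_def N_def mult_pos_neg)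
    ultimately show "c w * (- c w') * (w \<bullet> w') \<le> 0" by (meson less_imp_le mult_pos_neg)
  qed
  finally have p0: "p = 0" by (metis antisym inner_eq_zero_iff inner_ge_zero)
  have "P = {}"
  proof (rule ccontr)
    assume "P \<noteq> {}"
    then have "(\<Sum>w\<in>P. c w * (w \<bullet> z)) < (\<Sum>w\<in>P. 0)"
      using z by (intro sum_strict_mono finPN) (auto simp: P_def mult_pos_neg)
    moreover have "p \<bullet> z = (\<Sum>w\<in>P. c w * (w \<bullet> z))" by (simp add: p_def inner_sum_left)
    ultimately show False using p0 by simp
  qed
  moreover have "N = {}"
  proof (rule ccontr)
    assume "N \<noteq> {}"
    then have "(\<Sum>w\<in>N. (- c w) * (w \<bullet> z)) < (\<Sum>w\<in>N. 0)"
      using z by (intro sum_strict_mono finPN) (auto simp: N_def mult_neg_neg)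
    moreover have "p \<bullet> z = (\<Sum>w\<in>N. (- c w) * (w \<bullet> z))" by (simp add: pN inner_sum_left)
    ultimately show False using p0 by simp
  qed
  ultimately show False using c(2) by (auto simp: P_def N_def) (metis linorder_neqE_linordered_idom)
qed

text \<open>Were all these inner products negative, the first \<open>k - 1\<close> vectors would be
  independent, with \<open>v k\<close> as test vector \<open>z\<close>, although they lie in a span
  of dimension below \<open>k - 1\<close>.\<close>

lemma exists_pair_inner_nonneg:
  fixes v :: "nat \<Rightarrow> 'a::euclidean_space"
  assumes D: "v ` {1..k} \<subseteq> span D" "finite D" "card D + 1 < k"
  shows "\<exists>i\<in>{1..k}. \<exists>j\<in>{1..k}. i \<noteq> j \<and> v i \<bullet> v j \<ge> 0"
proof (rule ccontr)
  assume "\<not> ?thesis"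
  then have neg: "v i \<bullet> v j < 0" if "i \<in> {1..k}" "j \<in> {1..k}" "i \<noteq> j" for i j
    using that not_le by blast
  \<comment> \<open>A repeated vector would give a nonnegative inner product; injectivity is needed
    to count the set \<open>?W\<close>.\<close>
  have inj: "inj_on v {1..k}"
  proof (rule inj_onI, rule ccontr)
    fix i j assume "i \<in> {1..k}" "j \<in> {1..k}" "v i = v j" "i \<noteq> j"
    then show False using neg[of i j] by (metis inner_ge_zero not_le)
  qed
  let ?W = "v ` {1..<k}"
  have "independent ?W"
    by (rule independent_if_pairwise_obtuse[where z = "v k"])
      (use neg D(3) in \<open>fastforce simp: pairwise_def\<close>)+
  moreover have "?W \<subseteq> span D" using D(1) by force
  ultimately have "card ?W \<le> card D"
    using D(2) independent_span_bound by blast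
  moreover have "card ?W = k - 1"
    by (subst card_image) (auto intro: inj_on_subset[OF inj])
  ultimately show False using D(3) by simp
qed

subsection \<open>The function \<open>\<zeta>\<close> and its inverse\<close>

text \<open>Homogeneity of degree one reduces every positive distance to distance 1, the case
  inverted by \<open>h\<close>.\<close>

lemma zeta_scale:
  assumes "d > 0"
  shows "zeta (d * t) d = d * zeta t 1"
proof -
  have "sqrt (d\<^sup>2 + (d * t)\<^sup>2) = sqrt (d\<^sup>2 * (1 + t\<^sup>2))" by (simp add: algebra_simps power_mult_distrib)
  also have "\<dots> = d * sqrt (1 + t\<^sup>2)" using assms by (simp add: real_sqrt_mult)
  finally show ?thesis using assms by (simp add: zeta_def algebra_simps)
qed

lemma zeta_1_deriv:
  assumes "t > 0"
  shows "((\<lambda>t. zeta t 1) has_real_derivative 1 - sqrt (1 + t\<^sup>2) / t) (at t)"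
proof -
  have pos: "1 + t\<^sup>2 > 0" by (simp add: add_pos_nonneg)
  have s: "sqrt ((1 / t)\<^sup>2 + 1) = sqrt (1 + t\<^sup>2) / t"
  proof -
    have "(1 / t)\<^sup>2 + 1 = (1 + t\<^sup>2) / t\<^sup>2" using assms by (simp add: field_simps)
    then show ?thesis using assms by (simp add: real_sqrt_divide)
  qed
  have "((\<lambda>t. 1 / t) has_real_derivative - (1 / t\<^sup>2)) (at t)"
    using assms by (auto intro!: derivative_eq_intros simp: power2_eq_square)
  then have "((\<lambda>t. arsinh (1 / t)) has_real_derivative
      1 / sqrt ((1 / t)\<^sup>2 + 1) * - (1 / t\<^sup>2)) (at t)"
    using DERIV_chain2[OF arsinh_real_has_field_derivative] by fast
  moreover have "((\<lambda>t. sqrt (1 + t\<^sup>2)) has_real_derivative t / sqrt (1 + t\<^sup>2)) (at t)"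
    using pos by (auto intro!: derivative_eq_intros simp: field_simps)
  ultimately have "((\<lambda>t. arsinh (1 / t) - sqrt (1 + t\<^sup>2) + t) has_real_derivative
      1 / sqrt ((1 / t)\<^sup>2 + 1) * - (1 / t\<^sup>2) - t / sqrt (1 + t\<^sup>2) + 1) (at t)"
    by (intro DERIV_add DERIV_diff DERIV_ident)
  moreover have "1 / sqrt ((1 / t)\<^sup>2 + 1) * - (1 / t\<^sup>2) - t / sqrt (1 + t\<^sup>2) + 1
      = 1 - sqrt (1 + t\<^sup>2) / t"
  proof -
    define r where "r = sqrt (1 + t\<^sup>2)"
    have r: "r > 0" "r * r = 1 + t * t" using pos by (auto simp: r_def power2_eq_square)
    have "1 / (r / t) * - (1 / t\<^sup>2) - t / r = - (1 + t * t) / (r * t)"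
      using r(1) assms by (simp add: field_simps power2_eq_square)
    also have "\<dots> = - (r / t)" unfolding r(2)[symmetric] using r(1) assms by simp
    finally show ?thesis by (simp add: s flip: r_def)
  qed
  ultimately show ?thesis by (simp add: zeta_def)
qed

text \<open>The derivative is negative since \<open>sqrt (1 + t\<^sup>2) > t\<close>. The limits,
  infinity at 0 and 0 at infinity, and the intermediate value theorem determine the image.\<close>

lemma zeta_1_bij: "bij_betw (\<lambda>t. zeta t 1) {0<..} {0<..}"
proof -
  have dec: "zeta b 1 < zeta a 1" if "0 < a" "a < b" for a b
  proof (rule DERIV_neg_imp_decreasing[OF \<open>a < b\<close>])
    fix t assume "a \<le> t" "t \<le> b"
    then have t: "t > 0" using that by simp
    have "sqrt (t\<^sup>2) < sqrt (1 + t\<^sup>2)" by (intro real_sqrt_less_mono) simp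
    then have "1 - sqrt (1 + t\<^sup>2) / t < 0" using t by simp
    then show "\<exists>y. ((\<lambda>t. zeta t 1) has_real_derivative y) (at t) \<and> y < 0"
      using zeta_1_deriv[OF t] by blast
  qed
  have top: "((\<lambda>t. zeta t 1) \<longlongrightarrow> 0) at_top"
    unfolding zeta_def arsinh_real_def by simp real_asymp
  have zero: "filterlim (\<lambda>t. zeta t 1) at_top (at_right 0)"
    unfolding zeta_def arsinh_real_def by simp real_asymp
  have ev: "\<forall>\<^sub>F t in at_top. zeta t 1 < e" if "e > 0" for e
    using order_tendstoD(2)[OF top that] .
  have pos: "zeta t 1 > 0" if "t > 0" for t
  proof -
    \<comment> \<open>The limit only yields a weak inequality; comparing \<open>t\<close> with
      \<open>t + 1\<close> makes it strict.\<close>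
    have "zeta (t + 1) 1 \<ge> 0"
    proof (rule tendsto_le[OF _ tendsto_const top])
      show "\<forall>\<^sub>F u in at_top. zeta u 1 \<le> zeta (t + 1) 1"
        using eventually_gt_at_top[of "t + 1"]
        by eventually_elim (use that in \<open>simp add: less_imp_le dec\<close>)
    qed simp
    then show ?thesis using dec[of t "t + 1"] that by simp
  qed
  have surj: "\<exists>t>0. zeta t 1 = y" if y: "y > 0" for y
  proof -
    have "\<forall>\<^sub>F t in at_right 0. zeta t 1 \<ge> y \<and> t > 0"
      using zero[unfolded filterlim_at_top, rule_format, of y] eventually_at_right_less[of "0::real"]
      by eventually_elim simp
    then obtain a where a: "zeta a 1 \<ge> y" "a > 0"
      using eventually_happens'[OF trivial_limit_at_right_real] by blast
    have "\<forall>\<^sub>F t in at_top. zeta t 1 < y \<and> t > a"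
      using ev[OF y] eventually_gt_at_top[of a] by eventually_elim simp
    then obtain b where b: "zeta b 1 < y" "b > a"
      using eventually_happens'[OF trivial_limit_at_top_linorder] by blast
    have "\<exists>t\<ge>a. t \<le> b \<and> zeta t 1 = y"
    proof (rule IVT2)
      show "\<forall>t. a \<le> t \<and> t \<le> b \<longrightarrow> isCont (\<lambda>t. zeta t 1) t"
        using a(2) zeta_1_deriv DERIV_isCont by (metis less_le_trans)
    qed (use a b in auto)
    then show ?thesis using a(2) by (metis less_le_trans)
  qed
  have "inj_on (\<lambda>t. zeta t 1) {0<..}"
    by (rule linorder_inj_onI) (use dec in force)+
  then show ?thesis using pos surj by (force simp: bij_betw_def)
qed

lemma
  assumes "s > 0"
  shows h_pos: "h s > 0" and zeta_h: "zeta (h s) 1 = s"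
proof -
  have "h s \<in> {0<..}" unfolding h_def using assms zeta_1_bij
    by (intro the_inv_into_into[where A = "{0<..}"]) (auto simp: bij_betw_def)
  then show "h s > 0" by simp
  show "zeta (h s) 1 = s"
    unfolding h_def using f_the_inv_into_f_bij_betw[OF zeta_1_bij, of s] assms by simp
qed

subsection \<open>The symmetrized Laplacian\<close>

text \<open>The isometry from the inner product weighted by \<open>m\<close> to the Euclidean
  one.\<close>

definition sqrt_measure_mult :: "('v::finite \<Rightarrow> real) \<Rightarrow> real ^ 'v \<Rightarrow> real ^ 'v" where
  "sqrt_measure_mult m f = (\<chi> x. sqrt (m x) * f $ x)"

text \<open>The conjugate of \<open>-\<Delta>\<close> by \<open>sqrt_measure_mult m\<close>, with
  the sign that makes it positive semidefinite.\<close>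

definition normalized_laplacian ::
    "('v::finite \<Rightarrow> 'v \<Rightarrow> real) \<Rightarrow> ('v \<Rightarrow> real) \<Rightarrow> real ^ 'v \<Rightarrow> real ^ 'v" where
  "normalized_laplacian \<mu> m f =
     (\<chi> x. (\<Sum>y\<in>UNIV. \<mu> x y * (f $ x / sqrt (m x) - f $ y / sqrt (m y))) / sqrt (m x))"

text \<open>The image of an indicator function under \<open>sqrt_measure_mult m\<close>; Euclidean
  inner products of such vectors are measures of intersections.\<close>

definition sqrt_indicator :: "('v::finite \<Rightarrow> real) \<Rightarrow> 'v set \<Rightarrow> real ^ 'v" where
  "sqrt_indicator m B = (\<chi> x. if x \<in> B then sqrt (m x) else 0)"

lemma linear_normalized_laplacian: "linear (normalized_laplacian \<mu> m)"
proof (rule linearI)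
  fix f g :: "real ^ 'a" and c :: real
  show "normalized_laplacian \<mu> m (f + g) = normalized_laplacian \<mu> m f + normalized_laplacian \<mu> m g"
    by (simp add: normalized_laplacian_def vec_eq_iff add_divide_distrib[symmetric]
        sum.distrib[symmetric])
      (auto simp: add_divide_distrib algebra_simps intro!: sum.cong)
  show "normalized_laplacian \<mu> m (c *\<^sub>R f) = c *\<^sub>R normalized_laplacian \<mu> m f"
    by (simp add: normalized_laplacian_def vec_eq_iff sum_distrib_left)
      (auto simp: algebra_simps sum_divide_distrib sum_distrib_left intro!: sum.cong)
qed

text \<open>With a symmetric weight inside \<open>F\<close>, this is the summation by parts behind
  the Dirichlet form.\<close>

lemma sum_symmetrize:
  fixes F :: "'v \<Rightarrow> 'v \<Rightarrow> real"
  shows "(\<Sum>x\<in>B. \<Sum>y\<in>B. F x y) = (\<Sum>x\<in>B. \<Sum>y\<in>B. F x y + F y x) / 2"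
  using sum.swap[of F B B] by (simp add: sum.distrib)

lemma graph_dist_self [simp]: "graph_dist \<mu> x x = 0"
  unfolding graph_dist_def by (rule Least_eq_0) simp

context finite_weighted_graph
begin

abbreviation "S \<equiv> normalized_laplacian \<mu> m"
abbreviation "D \<equiv> max_degree \<mu> m"

section \<open>Transport of the spectrum along the conjugation\<close>

lemma normalized_laplacian_conjugate:
  "S (sqrt_measure_mult m f) = sqrt_measure_mult m (- laplacian \<mu> m f)"
proof -
  have "(\<Sum>y\<in>UNIV. \<mu> x y * (f $ x - f $ y)) / sqrt (m x)
      = sqrt (m x) * - (1 / m x * (\<Sum>y\<in>UNIV. \<mu> x y * (f $ y - f $ x)))" for x
  proof -
    have "(\<Sum>y\<in>UNIV. \<mu> x y * (f $ x - f $ y)) = - (\<Sum>y\<in>UNIV. \<mu> x y * (f $ y - f $ x))"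
      by (simp add: sum_negf[symmetric] algebra_simps)
    moreover have "m x = sqrt (m x) * sqrt (m x)" using measure_pos[of x] by simp
    ultimately show ?thesis using measure_pos[of x]
      by (smt (verit) divide_divide_eq_left divide_minus_left mult_cancel_right1 mult_minus_right
          nonzero_mult_div_cancel_left real_sqrt_gt_zero times_divide_eq_left times_divide_eq_right)
  qed
  moreover have "sqrt (m x) \<noteq> 0" for x using measure_pos[of x] by simp
  ultimately show ?thesis
    by (simp add: normalized_laplacian_def sqrt_measure_mult_def laplacian_def vec_eq_iff)
qed

lemma bij_sqrt_measure_mult: "bij (sqrt_measure_mult m)"
proof (rule bijI)
  have w: "sqrt (m x) \<noteq> 0" for x using measure_pos[of x] by simp
  show "inj (sqrt_measure_mult m)"
    using w by (auto simp: inj_def sqrt_measure_mult_def vec_eq_iff)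
  show "surj (sqrt_measure_mult m)"
  proof (rule surjI)
    show "sqrt_measure_mult m (\<chi> x. g $ x / sqrt (m x)) = g" for g :: "real ^ 'v"
      using w by (simp add: sqrt_measure_mult_def vec_eq_iff)
  qed
qed

lemma linear_sqrt_measure_mult: "linear (sqrt_measure_mult m)"
  by (rule linearI) (auto simp: sqrt_measure_mult_def vec_eq_iff algebra_simps)

text \<open>Whole eigenspaces are carried over, so multiplicities agree as well as
  eigenvalues.\<close>

lemma image_eigenspace:
  "sqrt_measure_mult m ` eigenspace \<mu> m c = {g. S g = c *\<^sub>R g}"
proof -
  have iff: "f \<in> eigenspace \<mu> m c \<longleftrightarrow> S (sqrt_measure_mult m f) = c *\<^sub>R sqrt_measure_mult m f" for f
    unfolding normalized_laplacian_conjugate eigenspace_def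
    using inj_eq[OF bij_is_inj[OF bij_sqrt_measure_mult], of "- laplacian \<mu> m f" "c *\<^sub>R f"]
    by (simp add: linear_scale[OF linear_sqrt_measure_mult])
  show ?thesis
  proof
    show "{g. S g = c *\<^sub>R g} \<subseteq> sqrt_measure_mult m ` eigenspace \<mu> m c"
    proof
      fix g assume "g \<in> {g. S g = c *\<^sub>R g}"
      moreover obtain f where "g = sqrt_measure_mult m f"
        using bij_is_surj[OF bij_sqrt_measure_mult] by blast
      ultimately show "g \<in> sqrt_measure_mult m ` eigenspace \<mu> m c" using iff by simp
    qed
  qed (use iff in auto)
qed

lemma dim_eigenspace: "dim (eigenspace \<mu> m c) = dim {g. S g = c *\<^sub>R g}"
  unfolding image_eigenspace[symmetric]
  by (rule dim_image_eq[symmetric, OF linear_sqrt_measure_mult])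
    (use bij_sqrt_measure_mult in \<open>auto simp: bij_def intro: inj_on_subset\<close>)

lemma spectrum_eq: "spectrum \<mu> m = {c. \<exists>g. g \<noteq> 0 \<and> S g = c *\<^sub>R g}"
proof -
  have "sqrt_measure_mult m f = 0 \<longleftrightarrow> f = 0" for f
    using inj_eq[OF bij_is_inj[OF bij_sqrt_measure_mult], of f 0]
    by (simp add: linear_0[OF linear_sqrt_measure_mult])
  moreover have "(\<exists>g. g \<noteq> 0 \<and> S g = c *\<^sub>R g)
      \<longleftrightarrow> (\<exists>g\<in>sqrt_measure_mult m ` eigenspace \<mu> m c. g \<noteq> 0)" for c
    by (auto simp: image_eigenspace)
  ultimately show ?thesis by (auto simp: spectrum_def)
qed

text \<open>The Dirichlet form of \<open>f / sqrt m\<close> and \<open>g / sqrt m\<close>;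
  selfadjointness, nonnegativity and the kernel are read off from it.\<close>

lemma normalized_laplacian_inner:
  "S f \<bullet> g = (\<Sum>x\<in>UNIV. \<Sum>y\<in>UNIV. \<mu> x y *
     ((f $ x / sqrt (m x) - f $ y / sqrt (m y)) * (g $ x / sqrt (m x) - g $ y / sqrt (m y)))) / 2"
proof -
  have "S f \<bullet> g = (\<Sum>x\<in>UNIV. \<Sum>y\<in>UNIV. \<mu> x y *
     ((f $ x / sqrt (m x) - f $ y / sqrt (m y)) * (g $ x / sqrt (m x))))"
    by (simp add: inner_vec_def normalized_laplacian_def sum_divide_distrib sum_distrib_left
        sum_distrib_right mult_ac)
  also have "\<dots> = (\<Sum>x\<in>UNIV. \<Sum>y\<in>UNIV.
      \<mu> x y * ((f $ x / sqrt (m x) - f $ y / sqrt (m y)) * (g $ x / sqrt (m x))) +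
      \<mu> y x * ((f $ y / sqrt (m y) - f $ x / sqrt (m x)) * (g $ y / sqrt (m y)))) / 2"
    by (rule sum_symmetrize)
  also have "\<dots> = (\<Sum>x\<in>UNIV. \<Sum>y\<in>UNIV. \<mu> x y *
     ((f $ x / sqrt (m x) - f $ y / sqrt (m y)) * (g $ x / sqrt (m x) - g $ y / sqrt (m y)))) / 2"
    by (intro arg_cong[where f = "\<lambda>z. z / 2"] sum.cong refl, subst (2) weight_sym)
      (simp add: algebra_simps)
  finally show ?thesis .
qed

lemma normalized_laplacian_selfadjoint: "S f \<bullet> g = f \<bullet> S g"
  by (simp add: normalized_laplacian_inner inner_commute[of f "S g"] mult.commute)

lemma normalized_laplacian_nonneg: "S f \<bullet> f \<ge> 0"
  unfolding normalized_laplacian_inner by (intro divide_nonneg_nonneg sum_nonneg mult_nonneg_nonneg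
      weight_nonneg zero_le_square) simp

text \<open>Zero energy forces \<open>f / sqrt m\<close> to agree across every edge, and
  connectedness makes it constant.\<close>

lemma normalized_laplacian_kernel:
  assumes "S f = 0"
  shows "\<exists>c. f = c *\<^sub>R sqrt_indicator m UNIV"
proof -
  let ?p = "\<lambda>x. f $ x / sqrt (m x)"
  let ?e = "\<lambda>x y. \<mu> x y * ((?p x - ?p y) * (?p x - ?p y))"
  have nn: "?e x y \<ge> 0" for x y using weight_nonneg by simp
  have "(\<Sum>x\<in>UNIV. \<Sum>y\<in>UNIV. ?e x y) = 0"
    using normalized_laplacian_inner[of f f] assms by simp
  then have "?e x y = 0" for x y
    using nn by (simp add: sum_nonneg_eq_0_iff sum_nonneg)
  then have edge: "?p x = ?p y" if "\<mu> x y > 0" for x y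
    using that by (metis eq_iff_diff_eq_0 less_irrefl mult_eq_0_iff)
  have const: "?p x = ?p y" for x y
    using connected[of x y]
    by (induction rule: rtrancl_induct) (auto simp: neighbors_def dest: edge)
  obtain z :: 'v where True by blast
  have "f = ?p z *\<^sub>R sqrt_indicator m UNIV"
  proof (simp only: vec_eq_iff, intro allI)
    fix x
    have "f $ x = ?p x * sqrt (m x)" using measure_pos[of x] by simp
    also have "\<dots> = (?p z *\<^sub>R sqrt_indicator m UNIV) $ x"
      unfolding const[of x z] by (simp add: sqrt_indicator_def)
    finally show "f $ x = (?p z *\<^sub>R sqrt_indicator m UNIV) $ x" .
  qed
  then show ?thesis by blast
qed

lemma normalized_laplacian_sqrt_indicator_UNIV: "S (sqrt_indicator m UNIV) = 0"
proof -
  have "sqrt (m x) \<noteq> 0" for x using measure_pos[of x] by simp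
  then show ?thesis by (simp add: normalized_laplacian_def sqrt_indicator_def vec_eq_iff)
qed

lemma inner_sqrt_indicator: "sqrt_indicator m B \<bullet> sqrt_indicator m C = sum m (B \<inter> C)"
proof -
  have "sqrt_indicator m B \<bullet> sqrt_indicator m C = (\<Sum>x\<in>UNIV. if x \<in> B \<inter> C then m x else 0)"
    using measure_pos by (auto simp: inner_vec_def sqrt_indicator_def less_imp_le intro!: sum.cong)
  then show ?thesis by (simp add: sum.If_cases Int_def)
qed

lemma sum_measure_pos: "B \<noteq> {} \<Longrightarrow> sum m B > 0"
  using measure_pos by (intro sum_pos) (auto intro: finite_subset)

lemma norm_sqrt_indicator: "norm (sqrt_indicator m B) = sqrt (sum m B)"
  by (simp add: norm_eq_sqrt_inner inner_sqrt_indicator)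

lemma weighted_degree_le: "weighted_degree \<mu> x \<le> D * m x"
proof -
  have "weighted_degree \<mu> x / m x \<le> D"
    unfolding max_degree_def by (intro Max_ge) auto
  then show ?thesis using measure_pos[of x] by (simp add: divide_le_eq)
qed

text \<open>A second vertex forces an edge at the first. A single vertex without a loop would have
  \<open>D = 0\<close>.\<close>

lemma max_degree_pos:
  assumes "CARD('v) > 1"
  shows "D > 0"
proof -
  obtain x y :: 'v where "x \<noteq> y"
    using assms by (metis One_nat_def UNIV_I card_le_Suc0_iff_eq finite not_le)
  then obtain z where "\<mu> x z > 0"
    using connected[of x y] by (auto simp: neighbors_def elim: converse_rtranclE)
  also have "\<mu> x z \<le> weighted_degree \<mu> x"
    unfolding weighted_degree_def using weight_nonneg by (intro member_le_sum) auto
  also have "\<dots> \<le> D * m x" by (rule weighted_degree_le)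
  finally show ?thesis using measure_pos[of x] by (simp add: zero_less_mult_iff)
qed

subsection \<open>The Davies-Gaffney estimate\<close>

text \<open>With \<open>p = exp \<psi> * f / sqrt m\<close>, symmetrizing produces edge terms
  \<open>2 cosh (\<psi> x - \<psi> y) p x p y - (p x)\<^sup>2 - (p y)\<^sup>2\<close>. Each is at
  most \<open>(cosh s - 1) ((p x)\<^sup>2 + (p y)\<^sup>2)\<close>, and summing over one endpoint
  brings in the degree.\<close>

lemma weighted_energy_dissipation:
  assumes lip: "\<And>x y. \<mu> x y > 0 \<Longrightarrow> \<bar>\<psi> x - \<psi> y\<bar> \<le> s"
  shows "- (\<Sum>x\<in>UNIV. exp (2 * \<psi> x) * (f $ x * S f $ x))
      \<le> D * (cosh s - 1) * (\<Sum>x\<in>UNIV. exp (2 * \<psi> x) * (f $ x)\<^sup>2)"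
proof -
  define q where "q x = f $ x / sqrt (m x)" for x
  define p where "p x = exp (\<psi> x) * q x" for x
  have "(\<Sum>x\<in>UNIV. exp (2 * \<psi> x) * (f $ x * S f $ x))
      = (\<Sum>x\<in>UNIV. \<Sum>y\<in>UNIV. \<mu> x y * ((p x)\<^sup>2 - exp (\<psi> x - \<psi> y) * p x * p y))"
  proof (intro sum.cong refl)
    fix x
    have "exp (2 * \<psi> x) * (f $ x * S f $ x) = (\<Sum>y\<in>UNIV. \<mu> x y *
        (exp (2 * \<psi> x) * q x * (q x - q y)))"
      by (simp add: q_def normalized_laplacian_def sum_distrib_left sum_divide_distrib mult_ac)
    also have "\<dots> = (\<Sum>y\<in>UNIV. \<mu> x y * ((p x)\<^sup>2 - exp (\<psi> x - \<psi> y) * p x * p y))"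
      unfolding exp_double by (intro sum.cong refl arg_cong2[where f = "(*)"])
        (simp add: p_def exp_diff power2_eq_square field_simps)
    finally show "exp (2 * \<psi> x) * (f $ x * S f $ x) = \<dots>" .
  qed
  also have "\<dots> = (\<Sum>x\<in>UNIV. \<Sum>y\<in>UNIV. \<mu> x y * ((p x)\<^sup>2 - exp (\<psi> x - \<psi> y) * p x * p y) +
      \<mu> y x * ((p y)\<^sup>2 - exp (\<psi> y - \<psi> x) * p y * p x)) / 2"
    by (rule sum_symmetrize)
  finally have "- (\<Sum>x\<in>UNIV. exp (2 * \<psi> x) * (f $ x * S f $ x))
      = (\<Sum>x\<in>UNIV. \<Sum>y\<in>UNIV. - (\<mu> x y * ((p x)\<^sup>2 - exp (\<psi> x - \<psi> y) * p x * p y) +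
      \<mu> y x * ((p y)\<^sup>2 - exp (\<psi> y - \<psi> x) * p y * p x))) / 2"
    by (simp only: sum_negf minus_divide_left)
  also have "\<dots> \<le> (\<Sum>x\<in>UNIV. \<Sum>y\<in>UNIV. \<mu> x y * ((cosh s - 1) * (p x)\<^sup>2) +
      \<mu> y x * ((cosh s - 1) * (p y)\<^sup>2)) / 2"
  proof (intro divide_right_mono sum_mono)
    fix x y
    have "- (\<mu> x y * ((p x)\<^sup>2 - exp (\<psi> x - \<psi> y) * p x * p y) +
        \<mu> x y * ((p y)\<^sup>2 - exp (\<psi> y - \<psi> x) * p y * p x))
        = \<mu> x y * (2 * cosh (\<psi> x - \<psi> y) * (p x * p y) - (p x)\<^sup>2 - (p y)\<^sup>2)"
      by (simp add: cosh_def algebra_simps)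
    also have "\<dots> \<le> \<mu> x y * ((cosh s - 1) * (p x)\<^sup>2 + (cosh s - 1) * (p y)\<^sup>2)"
    proof (cases "\<mu> x y > 0")
      case False
      then show ?thesis using weight_nonneg[of x y] by simp
    next
      case True
      have "cosh (\<psi> x - \<psi> y) \<le> cosh s"
        using lip[OF True] cosh_real_nonneg_le_iff[of "\<bar>\<psi> x - \<psi> y\<bar>" s]
        by (auto simp: abs_if split: if_splits) (metis cosh_minus minus_diff_eq)
      moreover have "2 * \<bar>p x * p y\<bar> \<le> (p x)\<^sup>2 + (p y)\<^sup>2"
        using sum_squares_bound[of "\<bar>p x\<bar>" "\<bar>p y\<bar>"] by (simp add: abs_mult)
      ultimately have le: "cosh (\<psi> x - \<psi> y) * (2 * \<bar>p x * p y\<bar>) \<le> cosh s * ((p x)\<^sup>2 + (p y)\<^sup>2)"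
        by (intro mult_mono) auto
      have "cosh (\<psi> x - \<psi> y) * (2 * (p x * p y)) \<le> cosh (\<psi> x - \<psi> y) * (2 * \<bar>p x * p y\<bar>)"
        by (intro mult_left_mono) auto
      from this le have "cosh (\<psi> x - \<psi> y) * (2 * (p x * p y)) \<le> cosh s * ((p x)\<^sup>2 + (p y)\<^sup>2)"
        by (rule order_trans)
      then show ?thesis
        using weight_nonneg by (intro mult_left_mono) (auto simp: algebra_simps)
    qed
    finally show "- (\<mu> x y * ((p x)\<^sup>2 - exp (\<psi> x - \<psi> y) * p x * p y) +
        \<mu> y x * ((p y)\<^sup>2 - exp (\<psi> y - \<psi> x) * p y * p x))
        \<le> \<mu> x y * ((cosh s - 1) * (p x)\<^sup>2) + \<mu> y x * ((cosh s - 1) * (p y)\<^sup>2)"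
      by (simp add: weight_sym[of y x] distrib_left)
  qed simp
  also have "\<dots> = (\<Sum>x\<in>UNIV. \<Sum>y\<in>UNIV. \<mu> x y * ((cosh s - 1) * (p x)\<^sup>2))"
    by (rule sum_symmetrize[symmetric])
  also have "\<dots> = (cosh s - 1) * (\<Sum>x\<in>UNIV. weighted_degree \<mu> x * (p x)\<^sup>2)"
    by (simp add: weighted_degree_def sum_distrib_left sum_distrib_right mult_ac)
  also have "\<dots> \<le> (cosh s - 1) * (\<Sum>x\<in>UNIV. D * m x * (p x)\<^sup>2)"
    using cosh_real_ge_1[of s] weighted_degree_le
    by (intro mult_left_mono sum_mono mult_right_mono) auto
  also have "\<dots> = D * (cosh s - 1) * (\<Sum>x\<in>UNIV. exp (2 * \<psi> x) * (f $ x)\<^sup>2)"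
  proof -
    have "m x * (p x)\<^sup>2 = exp (2 * \<psi> x) * (f $ x)\<^sup>2" for x
      using measure_pos[of x] by (simp add: p_def q_def power_divide power_mult_distrib exp_double)
    then show ?thesis by (simp add: sum_distrib_left mult.assoc mult.left_commute)
  qed
  finally show ?thesis .
qed

text \<open>Gronwall's argument: by the dissipation estimate, \<open>E t * exp (- 2 * c * t)\<close>
  has nonpositive derivative.\<close>

lemma weighted_energy_growth:
  assumes lip: "\<And>x y. \<mu> x y > 0 \<Longrightarrow> \<bar>\<psi> x - \<psi> y\<bar> \<le> s"
    and heat: "\<And>x t. ((\<lambda>t. u t $ x) has_real_derivative - (S (u t) $ x)) (at t)"
    and "t \<ge> 0"
  shows "(\<Sum>x\<in>UNIV. exp (2 * \<psi> x) * (u t $ x)\<^sup>2)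
      \<le> exp (2 * t * (D * (cosh s - 1))) * (\<Sum>x\<in>UNIV. exp (2 * \<psi> x) * (u 0 $ x)\<^sup>2)"
proof -
  define c where "c = D * (cosh s - 1)"
  define E where "E t = (\<Sum>x\<in>UNIV. exp (2 * \<psi> x) * (u t $ x)\<^sup>2)" for t
  define E' where "E' t = - (\<Sum>x\<in>UNIV. exp (2 * \<psi> x) * (u t $ x * S (u t) $ x))" for t
  have dE: "(E has_real_derivative 2 * E' r) (at r)" for r
    unfolding E_def [abs_def] E'_def sum_negf[symmetric] sum_distrib_left
    by (intro DERIV_sum) (auto intro!: derivative_eq_intros heat)
  have le: "E' r \<le> c * E r" for r
    unfolding E_def E'_def c_def by (rule weighted_energy_dissipation[OF lip])
  have "E t * exp (- 2 * c * t) \<le> E 0 * exp (- 2 * c * 0)"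
  proof (rule DERIV_nonpos_imp_nonincreasing[OF \<open>t \<ge> 0\<close>])
    fix r :: real
    have "((\<lambda>t. E t * exp (- 2 * c * t)) has_real_derivative
        2 * (E' r - c * E r) * exp (- 2 * c * r)) (at r)"
      by (auto intro!: derivative_eq_intros dE simp: algebra_simps)
    moreover have "2 * (E' r - c * E r) * exp (- 2 * c * r) \<le> 0"
      using le[of r] by (simp add: mult_le_0_iff)
    ultimately show "\<exists>y. ((\<lambda>t. E t * exp (- 2 * c * t)) has_real_derivative y) (at r) \<and> y \<le> 0"
      by blast
  qed
  then have "E t \<le> exp (2 * t * c) * E 0" by (simp add: exp_minus field_simps)
  then show ?thesis by (simp add: E_def c_def)
qed

text \<open>Pair \<open>exp \<psi> * u t\<close> with \<open>exp (- \<psi>) * g\<close> by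
  Cauchy-Schwarz. The first factor grows at the controlled rate from at most
  \<open>exp (- r) * norm (u 0)\<close>; the second is no larger than \<open>g\<close>, as
  \<open>\<psi> \<ge> 0\<close> on its support.\<close>

lemma davies_gaffney:
  assumes lip: "\<And>x y. \<mu> x y > 0 \<Longrightarrow> \<bar>\<psi> x - \<psi> y\<bar> \<le> s"
    and heat: "\<And>x t. ((\<lambda>t. u t $ x) has_real_derivative - (S (u t) $ x)) (at t)"
    and "t \<ge> 0"
    and u0: "\<And>x. u 0 $ x \<noteq> 0 \<Longrightarrow> \<psi> x \<le> - r" and g: "\<And>x. g $ x \<noteq> 0 \<Longrightarrow> \<psi> x \<ge> 0"
  shows "u t \<bullet> g \<le> exp (t * (D * (cosh s - 1)) - r) * norm (u 0) * norm g"
proof -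
  define U where "U = (\<chi> x. exp (\<psi> x) * u t $ x)"
  define G where "G = (\<chi> x. exp (- \<psi> x) * g $ x)"
  let ?c = "D * (cosh s - 1)"
  have "u t \<bullet> g = U \<bullet> G"
    unfolding inner_vec_def U_def G_def by (intro sum.cong) (auto simp: exp_minus field_simps)
  also have "\<dots> \<le> norm U * norm G" by (rule norm_cauchy_schwarz)
  also have "\<dots> \<le> (exp (t * ?c - r) * norm (u 0)) * norm g"
  proof (intro mult_mono)
    have "(norm U)\<^sup>2 = (\<Sum>x\<in>UNIV. exp (2 * \<psi> x) * (u t $ x)\<^sup>2)"
      unfolding power2_norm_eq_inner exp_double
      by (simp add: inner_vec_def U_def power2_eq_square mult_ac)
    also have "\<dots> \<le> exp (2 * t * ?c) * (\<Sum>x\<in>UNIV. exp (2 * \<psi> x) * (u 0 $ x)\<^sup>2)"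
      by (rule weighted_energy_growth[OF lip heat \<open>t \<ge> 0\<close>])
    also have "\<dots> \<le> exp (2 * t * ?c) * (\<Sum>x\<in>UNIV. exp (- 2 * r) * (u 0 $ x)\<^sup>2)"
    proof (intro mult_left_mono sum_mono)
      show "exp (2 * \<psi> x) * (u 0 $ x)\<^sup>2 \<le> exp (- 2 * r) * (u 0 $ x)\<^sup>2" for x
        using u0[of x] by (cases "u 0 $ x = 0") auto
    qed simp
    also have "\<dots> = (exp (t * ?c - r) * norm (u 0))\<^sup>2"
    proof -
      have "exp (2 * t * ?c) * exp (- 2 * r) = (exp (t * ?c - r))\<^sup>2"
        unfolding exp_double[symmetric] mult_exp_exp by (simp add: algebra_simps)
      moreover have "(norm (u 0))\<^sup>2 = (\<Sum>x\<in>UNIV. (u 0 $ x)\<^sup>2)"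
        unfolding power2_norm_eq_inner by (simp add: inner_vec_def power2_eq_square)
      ultimately show ?thesis
        by (simp only: power_mult_distrib sum_distrib_left[symmetric] mult.assoc[symmetric])
    qed
    finally show "norm U \<le> exp (t * ?c - r) * norm (u 0)"
      by (rule power2_le_imp_le) simp
    have "(norm G)\<^sup>2 \<le> (norm g)\<^sup>2"
      unfolding power2_norm_eq_inner inner_vec_def
    proof (intro sum_mono)
      fix x
      show "G $ x \<bullet> G $ x \<le> g $ x \<bullet> g $ x"
      proof (cases "g $ x = 0")
        case False
        then have "exp (- \<psi> x) * exp (- \<psi> x) \<le> 1 * 1" using g by (intro mult_mono) auto
        then have "exp (- \<psi> x) * exp (- \<psi> x) * (g $ x * g $ x) \<le> 1 * (g $ x * g $ x)"
          by (intro mult_right_mono) auto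
        then show ?thesis by (simp add: G_def mult_ac)
      qed (simp add: G_def)
    qed
    then show "norm G \<le> norm g" by (rule power2_le_imp_le) simp
  qed simp_all
  finally show ?thesis .
qed

section \<open>The distance to a set as Davies weight\<close>

lemma graph_dist_edge:
  assumes "\<mu> x y > 0"
  shows "graph_dist \<mu> x z \<le> Suc (graph_dist \<mu> y z)"
proof -
  have "\<exists>n. (y, z) \<in> neighbors \<mu> ^^ n" using connected[of y z] by (simp add: rtrancl_power)
  then have "(y, z) \<in> neighbors \<mu> ^^ graph_dist \<mu> y z" unfolding graph_dist_def by (rule LeastI_ex)
  then have "(x, z) \<in> neighbors \<mu> ^^ Suc (graph_dist \<mu> y z)"
    using assms by (intro relpow_Suc_I2) (auto simp: neighbors_def)
  then show ?thesis unfolding graph_dist_def[of _ x] by (rule Least_le)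
qed

lemma graph_dist_eq_0: "graph_dist \<mu> x y = 0 \<longleftrightarrow> x = y"
proof
  assume "graph_dist \<mu> x y = 0"
  moreover have "\<exists>n. (x, y) \<in> neighbors \<mu> ^^ n" using connected[of x y] by (simp add: rtrancl_power)
  then have "(x, y) \<in> neighbors \<mu> ^^ graph_dist \<mu> x y" unfolding graph_dist_def by (rule LeastI_ex)
  ultimately show "x = y" by simp
qed simp

text \<open>Follow the edge, then go to the point of \<open>B\<close> nearest to \<open>y\<close>.
  Used in both directions, this makes multiples of the distance to \<open>B\<close> admissible in
  \<open>davies_gaffney\<close>.\<close>

lemma Min_graph_dist_edge:
  assumes "\<mu> x y > 0" "B \<noteq> {}"
  shows "Min (graph_dist \<mu> x ` B) \<le> Suc (Min (graph_dist \<mu> y ` B))"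
proof -
  have "Min (graph_dist \<mu> y ` B) \<in> graph_dist \<mu> y ` B" using assms(2) by (intro Min_in) auto
  then obtain b where "b \<in> B" "Min (graph_dist \<mu> y ` B) = graph_dist \<mu> y b" by auto
  then show ?thesis using graph_dist_edge[OF assms(1), of b] by (auto intro: Min.coboundedI[THEN order_trans])
qed

lemma heat_kernel_sets:
  assumes heat: "\<And>x t. ((\<lambda>t. u t $ x) has_real_derivative - (S (u t) $ x)) (at t)"
    and u0: "u 0 = sqrt_indicator m A" and "B \<noteq> {}"
    and d: "\<And>a b. a \<in> A \<Longrightarrow> b \<in> B \<Longrightarrow> d \<le> graph_dist \<mu> a b" and "t > 0" "D > 0"
  shows "u t \<bullet> sqrt_indicator m B \<le> exp (- zeta (D * t) (real d)) * sqrt (sum m A * sum m B)"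
proof -
  \<comment> \<open>The minimizer of \<open>D * t * (cosh s - 1) - s * d\<close>, where
    \<open>sinh s = d / (D * t)\<close>; the minimum is \<open>- zeta (D * t) d\<close>.\<close>
  define s where "s = arsinh (d / (D * t))"
  \<comment> \<open>Zero on \<open>B\<close>, at most \<open>- s * d\<close> on \<open>A\<close>,
    and varying by at most \<open>s\<close> along edges.\<close>
  define \<psi> where "\<psi> x = - (s * real (Min (graph_dist \<mu> x ` B)))" for x
  have Dt: "D * t > 0" using assms by simp
  have "\<not> s < 0" unfolding s_def arsinh_real_neg_iff using Dt by (simp add: not_less)
  then have s: "s \<ge> 0" by simp
  have "u t \<bullet> sqrt_indicator m B
      \<le> exp (t * (D * (cosh s - 1)) - s * d) * norm (u 0) * norm (sqrt_indicator m B)"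
  proof (rule davies_gaffney[OF _ heat])
    fix x y assume e: "\<mu> x y > 0"
    then have "\<mu> y x > 0" by (simp add: weight_sym)
    note Min_graph_dist_edge[OF e \<open>B \<noteq> {}\<close>] Min_graph_dist_edge[OF this \<open>B \<noteq> {}\<close>]
    then have "\<bar>real (Min (graph_dist \<mu> x ` B)) - real (Min (graph_dist \<mu> y ` B))\<bar> \<le> 1" by linarith
    then have "s * \<bar>real (Min (graph_dist \<mu> x ` B)) - real (Min (graph_dist \<mu> y ` B))\<bar> \<le> s * 1"
      using s by (intro mult_left_mono)
    moreover have "\<psi> x - \<psi> y = - (s * (real (Min (graph_dist \<mu> x ` B)) - real (Min (graph_dist \<mu> y ` B))))"
      by (simp add: \<psi>_def algebra_simps)
    ultimately show "\<bar>\<psi> x - \<psi> y\<bar> \<le> s" using s by (simp add: abs_mult)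
  next
    fix x assume "u 0 $ x \<noteq> 0"
    then have "x \<in> A" by (auto simp: u0 sqrt_indicator_def split: if_splits)
    then have "d \<le> Min (graph_dist \<mu> x ` B)" using d \<open>B \<noteq> {}\<close> by simp
    then show "\<psi> x \<le> - (s * d)" using s by (simp add: \<psi>_def mult_left_mono)
  next
    fix x assume "sqrt_indicator m B $ x \<noteq> 0"
    then have "x \<in> B" by (auto simp: sqrt_indicator_def split: if_splits)
    then have "Min (graph_dist \<mu> x ` B) \<le> 0" by (intro Min.coboundedI) (auto simp: image_iff intro: bexI[of _ x])
    then show "\<psi> x \<ge> 0" by (simp add: \<psi>_def)
  qed (use \<open>t > 0\<close> in auto)
  moreover have "t * (D * (cosh s - 1)) - s * d = - zeta (D * t) d"
  proof -
    define T where "T = D * t"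
    have T: "T > 0" using Dt by (simp add: T_def)
    have "T * cosh s = T * sqrt ((d\<^sup>2 + T\<^sup>2) / T\<^sup>2)"
      using T by (simp add: s_def cosh_arsinh_real power_divide add_divide_distrib flip: T_def)
    also have "\<dots> = sqrt (d\<^sup>2 + T\<^sup>2)"
      using T by (simp add: real_sqrt_divide)
    finally have "T * (cosh s - 1) - s * d = - zeta T d"
      by (simp add: zeta_def s_def T_def[symmetric] right_diff_distrib)
    then show ?thesis by (simp add: T_def mult_ac)
  qed
  ultimately show ?thesis by (simp add: u0 norm_sqrt_indicator real_sqrt_mult)
qed

end

subsection \<open>Heat kernel expansion in an eigenbasis\<close>

text \<open>Positions count from 0, so \<open>lam (k - 1)\<close> is the \<open>k\<close>-th
  eigenvalue.\<close>

locale weighted_graph_eigenbasis = finite_weighted_graph \<mu> m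
  for \<mu> :: "'v::finite \<Rightarrow> 'v \<Rightarrow> real" and m :: "'v \<Rightarrow> real" +
  fixes \<phi> :: "nat \<Rightarrow> real ^ 'v" and lam :: "nat \<Rightarrow> real"
  assumes orthonormal: "i < CARD('v) \<Longrightarrow> j < CARD('v) \<Longrightarrow> \<phi> i \<bullet> \<phi> j = (if i = j then 1 else 0)"
    and eigenvector: "i < CARD('v) \<Longrightarrow> normalized_laplacian \<mu> m (\<phi> i) = lam i *\<^sub>R \<phi> i"
    and expansion: "(\<Sum>i<CARD('v). (x \<bullet> \<phi> i) *\<^sub>R \<phi> i) = x"
    and lam_mono: "i \<le> j \<Longrightarrow> j < CARD('v) \<Longrightarrow> lam i \<le> lam j"
    and eigenvalues_eq: "eigenvalues \<mu> m = map lam [0..<CARD('v)]"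
begin

abbreviation "g \<equiv> sqrt_indicator m"

lemma lam_nonneg: "i < CARD('v) \<Longrightarrow> lam i \<ge> 0"
  using normalized_laplacian_nonneg[of "\<phi> i"] by (simp add: eigenvector orthonormal)

lemma parseval: "x \<bullet> y = (\<Sum>i<CARD('v). (x \<bullet> \<phi> i) * (y \<bullet> \<phi> i))"
proof -
  have "x \<bullet> y = (\<Sum>i<CARD('v). (x \<bullet> \<phi> i) *\<^sub>R \<phi> i) \<bullet> y" by (simp only: expansion)
  also have "\<dots> = (\<Sum>i<CARD('v). (x \<bullet> \<phi> i) * (\<phi> i \<bullet> y))"
    by (simp only: inner_sum_left inner_scaleR_left)
  finally show ?thesis by (simp only: inner_commute[of y])
qed

lemma sqrt_indicator_UNIV_neq_0: "g UNIV \<noteq> 0"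
  using norm_sqrt_indicator[of UNIV] sum_measure_pos[of UNIV] by auto

text \<open>Otherwise all eigenvalues are positive, and the kernel vector \<open>g UNIV\<close> is
  orthogonal to the whole basis.\<close>

lemma lam_0: "lam 0 = 0"
proof (rule ccontr)
  assume "lam 0 \<noteq> 0"
  then have pos: "lam i > 0" if "i < CARD('v)" for i
    using lam_nonneg[of 0] lam_mono[of 0 i] that by force
  have "g UNIV \<bullet> \<phi> i = 0" if "i < CARD('v)" for i
  proof -
    have "lam i * (g UNIV \<bullet> \<phi> i) = g UNIV \<bullet> S (\<phi> i)" by (simp add: eigenvector that)
    also have "\<dots> = 0"
      by (simp add: normalized_laplacian_selfadjoint[symmetric] normalized_laplacian_sqrt_indicator_UNIV)
    finally show ?thesis using pos[OF that] by simp
  qed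
  then have "g UNIV = 0" using expansion[of "g UNIV"] by simp
  then show False using sqrt_indicator_UNIV_neq_0 by simp
qed

text \<open>Otherwise \<open>\<phi> 0\<close> and \<open>\<phi> 1\<close> are orthonormal vectors in
  a one-dimensional kernel.\<close>

lemma lam_1_pos:
  assumes "1 < CARD('v)"
  shows "lam 1 > 0"
proof (rule ccontr)
  assume "\<not> lam 1 > 0"
  then have "lam 1 = 0" using lam_nonneg[OF assms] by simp
  then have "S (\<phi> 0) = 0" "S (\<phi> 1) = 0" using eigenvector[of 0] eigenvector[of 1] lam_0 assms by auto
  then obtain a b where ab: "\<phi> 0 = a *\<^sub>R g UNIV" "\<phi> 1 = b *\<^sub>R g UNIV"
    using normalized_laplacian_kernel by meson
  have "\<phi> 0 \<bullet> \<phi> 0 = 1" "\<phi> 1 \<bullet> \<phi> 1 = 1" "\<phi> 0 \<bullet> \<phi> 1 = 0"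
    using orthonormal assms by auto
  then show False using ab by auto
qed

text \<open>\<open>\<phi> 0\<close> is the normalized \<open>g UNIV\<close> only up to sign; in a
  product of two coefficients the sign cancels.\<close>

lemma inner_phi_0_mult:
  "(g B \<bullet> \<phi> 0) * (g C \<bullet> \<phi> 0) = sum m B * sum m C / sum m UNIV"
proof -
  have "S (\<phi> 0) = 0" using eigenvector[of 0] lam_0 by simp
  then obtain c where c: "\<phi> 0 = c *\<^sub>R g UNIV" using normalized_laplacian_kernel by meson
  have "\<phi> 0 \<bullet> \<phi> 0 = 1" using orthonormal[of 0 0] by simp
  then have "c * c = 1 / sum m UNIV"
    using sum_measure_pos[of UNIV] by (simp add: c inner_sqrt_indicator field_simps)
  moreover have "(g B \<bullet> \<phi> 0) * (g C \<bullet> \<phi> 0) = (c * c) * (sum m B * sum m C)"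
    by (simp add: c inner_sqrt_indicator)
  ultimately show ?thesis by simp
qed

text \<open>The semigroup \<open>exp (- t S) f\<close> in the eigenbasis.\<close>

definition heat :: "real ^ 'v \<Rightarrow> real \<Rightarrow> real ^ 'v" where
  "heat f t = (\<Sum>l<CARD('v). (exp (- t * lam l) * (f \<bullet> \<phi> l)) *\<^sub>R \<phi> l)"

lemma heat_0: "heat f 0 = f"
  by (simp add: heat_def expansion)

lemma heat_inner: "heat f t \<bullet> f' = (\<Sum>l<CARD('v). exp (- t * lam l) * ((f \<bullet> \<phi> l) * (f' \<bullet> \<phi> l)))"
  by (simp add: heat_def inner_sum_left inner_commute[of f'] mult.assoc)

lemma heat_deriv: "((\<lambda>t. heat f t $ x) has_real_derivative - (S (heat f t) $ x)) (at t)"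
proof -
  have "S (heat f t) = (\<Sum>l<CARD('v). (exp (- t * lam l) * (f \<bullet> \<phi> l) * lam l) *\<^sub>R \<phi> l)"
    by (simp add: heat_def linear_sum[OF linear_normalized_laplacian]
        linear_scale[OF linear_normalized_laplacian] eigenvector)
  then have "- (S (heat f t) $ x) = (\<Sum>l<CARD('v). - (exp (- t * lam l) * (f \<bullet> \<phi> l) * lam l * \<phi> l $ x))"
    by (simp add: sum_negf)
  moreover have "((\<lambda>t. \<Sum>l<CARD('v). exp (- t * lam l) * (f \<bullet> \<phi> l) * \<phi> l $ x) has_real_derivative
      (\<Sum>l<CARD('v). - (exp (- t * lam l) * (f \<bullet> \<phi> l) * lam l * \<phi> l $ x))) (at t)"
    by (intro DERIV_sum) (auto intro!: derivative_eq_intros)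
  ultimately show ?thesis by (simp add: heat_def)
qed

text \<open>Cauchy-Schwarz for the coefficients, with Parseval; a general \<open>L\<close> allows
  bounding the high modes alone.\<close>

lemma sum_abs_inner_le:
  assumes "L \<subseteq> {..<CARD('v)}"
  shows "(\<Sum>l\<in>L. \<bar>(x \<bullet> \<phi> l) * (y \<bullet> \<phi> l)\<bar>) \<le> norm x * norm y"
proof -
  have "(\<Sum>l\<in>L. \<bar>(x \<bullet> \<phi> l) * (y \<bullet> \<phi> l)\<bar>) \<le> (\<Sum>l<CARD('v). \<bar>x \<bullet> \<phi> l\<bar> * \<bar>y \<bullet> \<phi> l\<bar>)"
    unfolding abs_mult by (intro sum_mono2 assms) auto
  also have "\<dots> \<le> L2_set (\<lambda>l. x \<bullet> \<phi> l) {..<CARD('v)} * L2_set (\<lambda>l. y \<bullet> \<phi> l) {..<CARD('v)}"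
    by (rule L2_set_mult_ineq)
  also have "\<dots> = norm x * norm y"
    by (simp add: L2_set_def norm_eq_sqrt_inner parseval[of x x] parseval[of y y] power2_eq_square)
  finally show ?thesis .
qed

text \<open>The constant mode contributes \<open>m(A\<^sub>i) m(A\<^sub>j) / m(V)\<close> to the heat kernel between \<open>A\<^sub>i\<close> and
  \<open>A\<^sub>j\<close>. The \<open>k\<close> vectors of Fourier coefficients at the modes strictly between the constant one and the
  \<open>k\<close>-th one (positions \<open>1, \<dots>, k - 2\<close>) live in dimension \<open>k - 2\<close>, so for some pair these modes contribute
  a nonnegative amount and only the modes from \<open>k\<close> on can compensate the constant mode.\<close>

lemma exp_eigenvalue_lower_bound:
  fixes A :: "nat \<Rightarrow> 'v set"
  assumes k: "2 \<le> k" "k \<le> CARD('v)" and "t > 0"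
  obtains i j where "i \<in> {1..k}" "j \<in> {1..k}" "i \<noteq> j"
    "sum m (A i) * sum m (A j) / sum m UNIV
      \<le> heat (g (A i)) t \<bullet> g (A j) + exp (- t * lam (k - 1)) * sqrt (sum m (A i) * sum m (A j))"
proof -
  let ?q = "\<lambda>l. exp (- t * lam l)"
  let ?I = "{1..<k - 1}" and ?J = "{k - 1..<CARD('v)}"
  \<comment> \<open>Each factor takes half of the exponent, so \<open>v i \<bullet> v j\<close> is
    exactly the contribution of the modes in \<open>?I\<close> to the heat kernel. For
    \<open>k = 2\<close> these vectors are zero.\<close>
  define v where "v i = (\<Sum>l\<in>?I. (exp (- t * lam l / 2) * (g (A i) \<bullet> \<phi> l)) *\<^sub>R \<phi> l)" for i
  have "v ` {1..k} \<subseteq> span (\<phi> ` ?I)"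
    unfolding v_def by (intro image_subsetI span_sum span_scale span_base imageI)
  moreover have "card (\<phi> ` ?I) + 1 < k" using card_image_le[of ?I \<phi>] k(1) by simp
  ultimately obtain i j where ij: "i \<in> {1..k}" "j \<in> {1..k}" "i \<noteq> j" "v i \<bullet> v j \<ge> 0"
    using exists_pair_inner_nonneg[of v k "\<phi> ` ?I"] by auto
  define a where "a l = (g (A i) \<bullet> \<phi> l) * (g (A j) \<bullet> \<phi> l)" for l
  have "v i \<bullet> v j = (\<Sum>l\<in>?I. ?q l * a l)"
  proof -
    have "v i \<bullet> \<phi> l = exp (- t * lam l / 2) * (g (A i) \<bullet> \<phi> l)" if l: "l \<in> ?I" for l
    proof -
      have "v i \<bullet> \<phi> l = (\<Sum>l'\<in>?I. if l' = l then exp (- t * lam l / 2) * (g (A i) \<bullet> \<phi> l) else 0)"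
        unfolding v_def inner_sum_left using l k by (intro sum.cong) (auto simp: orthonormal)
      then show ?thesis using l by (simp add: sum.delta')
    qed
    moreover have "v i \<bullet> v j = (\<Sum>l\<in>?I. exp (- t * lam l / 2) * (g (A j) \<bullet> \<phi> l) * (v i \<bullet> \<phi> l))"
      by (simp add: v_def[of j] inner_sum_right)
    ultimately have "v i \<bullet> v j = (\<Sum>l\<in>?I. (exp (- t * lam l / 2) * exp (- t * lam l / 2)) * a l)"
      by (auto simp: a_def intro!: sum.cong)
    then show ?thesis by (simp add: exp_add[symmetric])
  qed
  moreover have "- (?q (k - 1) * sqrt (sum m (A i) * sum m (A j))) \<le> (\<Sum>l\<in>?J. ?q l * a l)"
  proof -
    \<comment> \<open>On \<open>?J\<close> the decay factor is largest at position
      \<open>k - 1\<close>, since \<open>lam\<close> is nondecreasing.\<close>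
    have "- (\<Sum>l\<in>?J. ?q l * a l) \<le> (\<Sum>l\<in>?J. ?q (k - 1) * \<bar>a l\<bar>)"
      unfolding sum_negf[symmetric]
    proof (intro sum_mono)
      fix l assume l: "l \<in> ?J"
      have "?q l * (- a l) \<le> ?q l * \<bar>a l\<bar>" by (intro mult_left_mono) auto
      then have "- (?q l * a l) \<le> ?q l * \<bar>a l\<bar>" by simp
      also have "\<dots> \<le> ?q (k - 1) * \<bar>a l\<bar>"
        using l lam_mono[of "k - 1" l] \<open>t > 0\<close> by (intro mult_right_mono) auto
      finally show "- (?q l * a l) \<le> ?q (k - 1) * \<bar>a l\<bar>" .
    qed
    also have "\<dots> \<le> ?q (k - 1) * (norm (g (A i)) * norm (g (A j)))"
      unfolding sum_distrib_left[symmetric] a_def by (intro mult_left_mono sum_abs_inner_le) auto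
    finally show ?thesis by (simp add: norm_sqrt_indicator real_sqrt_mult)
  qed
  moreover have "heat (g (A i)) t \<bullet> g (A j)
      = sum m (A i) * sum m (A j) / sum m UNIV + (\<Sum>l\<in>?I. ?q l * a l) + (\<Sum>l\<in>?J. ?q l * a l)"
  proof -
    have "{..<CARD('v)} = insert 0 (?I \<union> ?J)" using k by auto
    moreover have "(\<Sum>l\<in>?I \<union> ?J. ?q l * a l) = (\<Sum>l\<in>?I. ?q l * a l) + (\<Sum>l\<in>?J. ?q l * a l)"
      by (intro sum.union_disjoint) auto
    moreover have "0 \<notin> ?I \<union> ?J" using k by auto
    ultimately show ?thesis
      unfolding heat_inner a_def[symmetric]
      by (simp add: lam_0 a_def[of 0] inner_phi_0_mult)
  qed
  ultimately show thesis using ij by (intro that[of i j]) auto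
qed

end

section \<open>Assembling the eigenvalue bound\<close>

context finite_weighted_graph
begin

lemma eigenbasis_exists: "\<exists>\<phi> lam. weighted_graph_eigenbasis \<mu> m \<phi> lam"
proof -
  obtain \<phi> :: "nat \<Rightarrow> real ^ 'v" and lam where
    "\<And>i j. i < DIM(real ^ 'v) \<Longrightarrow> j < DIM(real ^ 'v) \<Longrightarrow> \<phi> i \<bullet> \<phi> j = (if i = j then 1 else 0)"
    "\<And>i. i < DIM(real ^ 'v) \<Longrightarrow> S (\<phi> i) = lam i *\<^sub>R \<phi> i"
    "\<And>x. (\<Sum>i<DIM(real ^ 'v). (x \<bullet> \<phi> i) *\<^sub>R \<phi> i) = x"
    "\<And>i j. i \<le> j \<Longrightarrow> j < DIM(real ^ 'v) \<Longrightarrow> lam i \<le> lam j"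
    "sorted_list_of_multiset
      (\<Sum>c | \<exists>x. x \<noteq> 0 \<and> S x = c *\<^sub>R x. replicate_mset (dim {x. S x = c *\<^sub>R x}) c)
      = map lam [0..<DIM(real ^ 'v)]"
    using selfadjoint_sorted_eigenbasis[OF linear_normalized_laplacian normalized_laplacian_selfadjoint]
    by blast
  then have "weighted_graph_eigenbasis \<mu> m \<phi> lam"
    by unfold_locales (simp_all add: eigenvalues_def spectrum_eq dim_eigenspace)
  then show ?thesis by blast
qed

end

theorem theorem4p1:
  fixes \<mu> :: "'v::finite \<Rightarrow> 'v \<Rightarrow> real" and m :: "'v \<Rightarrow> real"
    and A :: "nat \<Rightarrow> 'v set" and k \<delta> :: nat
  assumes "finite_weighted_graph \<mu> m"
    and "k \<ge> 2"
    and "disjoint_family_on A {1..k}"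
    and "\<And>i. i \<in> {1..k} \<Longrightarrow> A i \<noteq> {}"
    and "\<delta> = Min {set_graph_dist \<mu> (A i) (A j) | i j. i \<in> {1..k} \<and> j \<in> {1..k} \<and> i \<noteq> j}"
  shows "length (eigenvalues \<mu> m) = CARD('v)
    \<and> 0 = eigval \<mu> m 1 \<and> eigval \<mu> m 1 < eigval \<mu> m 2
    \<and> eigval \<mu> m k \<le> max_degree \<mu> m / real \<delta> *
        Max {ln (2 * sum m UNIV / sqrt (sum m (A i) * sum m (A j))) /
             h (2 / real \<delta> * ln (2 * sum m UNIV / sqrt (sum m (A i) * sum m (A j))))
            | i j. i \<in> {1..k} \<and> j \<in> {1..k} \<and> i \<noteq> j}"
proof -
  interpret finite_weighted_graph \<mu> m by fact
  obtain \<phi> lam where "weighted_graph_eigenbasis \<mu> m \<phi> lam" using eigenbasis_exists by blast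
  then interpret weighted_graph_eigenbasis \<mu> m \<phi> lam .
  note ne = assms(4)
  \<comment> \<open>Representatives of the disjoint sets are distinct, so
    \<open>eigval \<mu> m k\<close> is a genuine list entry.\<close>
  have k: "2 \<le> k" "k \<le> CARD('v)"
  proof -
    define a where "a i = (SOME x. x \<in> A i)" for i
    have a: "a i \<in> A i" if "i \<in> {1..k}" for i
      unfolding a_def using ne[OF that] by (simp add: some_in_eq)
    have "inj_on a {1..k}"
    proof (rule inj_onI, rule ccontr)
      fix i j assume ij: "i \<in> {1..k}" "j \<in> {1..k}" "a i = a j" "i \<noteq> j"
      then have "A i \<inter> A j = {}" using assms(3) by (simp add: disjoint_family_on_def)
      then show False using a[OF ij(1)] a[OF ij(2)] ij(3) by auto
    qed
    then have "card {1..k} \<le> CARD('v)" by (rule card_inj_on_le) auto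
    then show "k \<le> CARD('v)" by simp
  qed (rule assms)
  define P where "P = {(i, j). i \<in> {1..k} \<and> j \<in> {1..k} \<and> i \<noteq> j}"
  have finP: "finite P" by (rule finite_subset[of _ "{1..k} \<times> {1..k}"]) (auto simp: P_def)
  have "(1, 2) \<in> P" using k by (auto simp: P_def)
  then have neP: "P \<noteq> {}" by blast
  define L where "L i j = ln (2 * sum m UNIV / sqrt (sum m (A i) * sum m (A j)))" for i j
  define R where "R = (\<lambda>(i, j). L i j / h (2 / real \<delta> * L i j))"
  define d where "d = (\<lambda>(i, j). set_graph_dist \<mu> (A i) (A j))"
  \<comment> \<open>As images of the finite nonempty set \<open>P\<close>, the index sets have
    attained minima and maxima.\<close>
  have setcomp: "{f i j | i j. i \<in> {1..k} \<and> j \<in> {1..k} \<and> i \<noteq> j} = (\<lambda>(i, j). f i j) ` P"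
    for f :: "nat \<Rightarrow> nat \<Rightarrow> 'b"
    by (auto simp: P_def)
  have \<delta>: "\<delta> = Min (d ` P)" using assms(5) unfolding setcomp d_def .

  have dist_le: "\<delta> \<le> graph_dist \<mu> x y" if "(i, j) \<in> P" "x \<in> A i" "y \<in> A j" for i j x y
  proof -
    let ?T = "{graph_dist \<mu> a b | a b. a \<in> A i \<and> b \<in> A j}"
    have "finite ?T" by (rule finite_subset[of _ "range (\<lambda>(a, b). graph_dist \<mu> a b)"]) auto
    then have "set_graph_dist \<mu> (A i) (A j) \<le> graph_dist \<mu> x y"
      unfolding set_graph_dist_def using that by (intro Min_le) auto
    moreover have "\<delta> \<le> d (i, j)" unfolding \<delta> using that finP by (intro Min_le) auto
    ultimately show ?thesis by (simp add: d_def)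
  qed
  \<comment> \<open>The minimum is attained at two vertices of disjoint sets, hence at distinct
    ones.\<close>
  have "\<delta> > 0"
  proof -
    have "\<delta> \<in> d ` P" unfolding \<delta> using finP neP by (intro Min_in) auto
    then obtain i j where ij: "(i, j) \<in> P" "\<delta> = set_graph_dist \<mu> (A i) (A j)"
      by (auto simp: d_def)
    let ?T = "{graph_dist \<mu> a b | a b. a \<in> A i \<and> b \<in> A j}"
    have "finite ?T" by (rule finite_subset[of _ "range (\<lambda>(a, b). graph_dist \<mu> a b)"]) auto
    moreover have "A i \<noteq> {}" "A j \<noteq> {}" using ij(1) by (simp_all add: P_def ne)
    then have "?T \<noteq> {}" by blast
    ultimately have "\<delta> \<in> ?T" unfolding ij(2) set_graph_dist_def by (rule Min_in)
    then obtain a b where ab: "\<delta> = graph_dist \<mu> a b" "a \<in> A i" "b \<in> A j" by blast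
    have "A i \<inter> A j = {}" using ij(1) assms(3) by (simp add: P_def disjoint_family_on_def)
    then have "a \<noteq> b" using ab by auto
    then show ?thesis using ab(1) graph_dist_eq_0[of a b] by simp
  qed

  have D: "D > 0" using max_degree_pos k by simp
  have M: "sum m UNIV > 0" by (rule sum_measure_pos) simp
  define r where "r i j = sqrt (sum m (A i) * sum m (A j))" for i j
  \<comment> \<open>Since \<open>r i j\<close> is at most the total measure, the 2 in the logarithm
    makes \<open>L i j\<close> positive, as \<open>h\<close> requires. It also makes
    \<open>exp (- L i j)\<close> half of \<open>r i j / sum m UNIV\<close>.\<close>
  have r: "0 < r i j" "L i j > 0" "exp (- L i j) = r i j / (2 * sum m UNIV)" if "(i, j) \<in> P" for i j
  proof -
    have pos: "sum m (A i) > 0" "sum m (A j) > 0" using that ne sum_measure_pos by (auto simp: P_def)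
    then show r0: "0 < r i j" by (simp add: r_def)
    have "sum m B \<le> sum m UNIV" for B using measure_pos by (intro sum_mono2) (auto intro: less_imp_le)
    then have "sum m (A i) * sum m (A j) \<le> (sum m UNIV)\<^sup>2"
      using pos M unfolding power2_eq_square by (intro mult_mono) (auto intro: less_imp_le)
    then have "r i j \<le> sum m UNIV"
      unfolding r_def using M by (intro real_le_lsqrt) auto
    then have "1 < 2 * sum m UNIV / r i j" using r0 M by (simp add: less_divide_eq)
    then show "L i j > 0" by (simp add: L_def r_def)
    show "exp (- L i j) = r i j / (2 * sum m UNIV)"
      using r0 M by (simp add: L_def exp_minus flip: r_def)
  qed
  obtain i0 j0 where P0: "(i0, j0) \<in> P" and Lmax: "\<And>i j. (i, j) \<in> P \<Longrightarrow> L i j \<le> L i0 j0"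
  proof -
    have "Max ((\<lambda>(i, j). L i j) ` P) \<in> (\<lambda>(i, j). L i j) ` P" using finP neP by (intro Max_in) auto
    then obtain i j where ij: "(i, j) \<in> P" "Max ((\<lambda>(i, j). L i j) ` P) = L i j" by auto
    have "L i' j' \<le> Max ((\<lambda>(i, j). L i j) ` P)" if "(i', j') \<in> P" for i' j'
      using finP that by (intro Max_ge) auto
    then show thesis using that ij by metis
  qed
  define L0 where "L0 = L i0 j0"
  have "L0 > 0" using r P0 by (simp add: L0_def)
  define \<tau> where "\<tau> = h (2 / real \<delta> * L0)"
  have \<tau>: "\<tau> > 0" "zeta \<tau> 1 = 2 / real \<delta> * L0"
    unfolding \<tau>_def using \<open>L0 > 0\<close> \<open>\<delta> > 0\<close> by (intro h_pos zeta_h; simp)+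
  \<comment> \<open>Solves \<open>D * t = \<delta> * \<tau>\<close>, so that scaling gives
    \<open>zeta (D * t) \<delta> = \<delta> * zeta \<tau> 1 = 2 * L0\<close>.\<close>
  define t where "t = \<delta> * \<tau> / D"
  have t: "t > 0" using \<tau> D \<open>\<delta> > 0\<close> by (simp add: t_def)
  have zeta: "zeta (D * t) \<delta> = 2 * L0"
    using zeta_scale[of "real \<delta>" \<tau>] \<tau> D \<open>\<delta> > 0\<close> by (simp add: t_def)

  \<comment> \<open>This pair depends on \<open>t\<close> and may differ from
    \<open>(i0, j0)\<close>; choosing \<open>t\<close> from the largest logarithm covers every
    pair.\<close>
  obtain i j where ij: "i \<in> {1..k}" "j \<in> {1..k}" "i \<noteq> j"
    and low: "sum m (A i) * sum m (A j) / sum m UNIV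
      \<le> heat (g (A i)) t \<bullet> g (A j) + exp (- t * lam (k - 1)) * sqrt (sum m (A i) * sum m (A j))"
    using exp_eigenvalue_lower_bound[OF k t] by blast
  have ijP: "(i, j) \<in> P" using ij by (simp add: P_def)
  note rij = r[OF ijP]
  have "heat (g (A i)) t \<bullet> g (A j) \<le> exp (- zeta (D * t) \<delta>) * r i j"
    unfolding r_def using dist_le[OF ijP] t D ne ij
    by (intro heat_kernel_sets) (auto simp: heat_0 intro: heat_deriv)
  also have "\<dots> \<le> exp (- L i j) * r i j"
  proof (rule mult_right_mono)
    have "L i j \<le> 2 * L0" using Lmax[OF ijP] \<open>L0 > 0\<close> by (simp add: L0_def)
    then show "exp (- zeta (D * t) \<delta>) \<le> exp (- L i j)" by (simp add: zeta)
  qed (use rij(1) in simp)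
  finally have "r i j * r i j / sum m UNIV \<le> (exp (- L i j) + exp (- t * lam (k - 1))) * r i j"
    using low rij(1) sum_measure_pos ne ij unfolding r_def
    by (simp add: algebra_simps less_imp_le)
  then have "(r i j / sum m UNIV) * r i j \<le> (exp (- L i j) + exp (- t * lam (k - 1))) * r i j"
    by simp
  then have "r i j / sum m UNIV \<le> exp (- L i j) + exp (- t * lam (k - 1))"
    using rij(1) by (rule mult_right_le_imp_le)
  \<comment> \<open>The left side of the previous inequality is \<open>2 * exp (- L i j)\<close>;
    the Davies bound accounts for one half, the high modes for the other.\<close>
  then have "exp (- L i j) \<le> exp (- t * lam (k - 1))" using rij(3) by (simp add: field_simps)
  then have "t * lam (k - 1) \<le> L0" using Lmax[OF ijP] by (simp add: L0_def)
  then have "lam (k - 1) \<le> D / \<delta> * (L0 / \<tau>)"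
    using D \<tau> \<open>\<delta> > 0\<close> by (simp add: t_def field_simps)
  also have "\<dots> \<le> D / \<delta> * Max (R ` P)"
  proof (intro mult_left_mono Max_ge)
    \<comment> \<open>By the choice of \<open>\<tau>\<close>, this is the entry of the pair
      \<open>(i0, j0)\<close>; no monotonicity of the quotient in \<open>L\<close> enters.\<close>
    show "L0 / \<tau> \<in> R ` P" using P0 by (force simp: R_def L0_def \<tau>_def)
  qed (use finP D in auto)
  finally have "lam (k - 1) \<le> D / \<delta> * Max (R ` P)" .
  moreover have "R ` P = {L i j / h (2 / real \<delta> * L i j) | i j. i \<in> {1..k} \<and> j \<in> {1..k} \<and> i \<noteq> j}"
    unfolding setcomp R_def ..
  ultimately show ?thesis
    using k lam_0 lam_1_pos by (simp add: eigval_def eigenvalues_eq L_def)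
qed

end
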